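(* Let $T>0$ and let $p\ge2$ be an even integer. For $N\ge1$ and $h=T/N$, let $S_h^p(0,T)$ be the space of $C^1([0,T])$ functions that are piecewise polynomials of degree $p$ on the uniform mesh $\{jh\}_{j=0}^N$ and vanish at $t=0$. Then these spaces satisfy the following: there exists a projection operator $Q_h:H^2_{0,\bullet}(0,T)\to S_h^p(0,T)$ such that, for every $u\in H^2_{0,\bullet}(0,T)$, $$\begin{cases}\partial_tQ_hu(T)=\partial_tu(T),\\ (\partial_tQ_hu,e^{-\bullet/T}\partial_t^2w_h)_{L^2(0,T)}=(\partial_tu,e^{-\bullet/T}\partial_t^2w_h)_{L^2(0,T)}\quad\text{for all }w_h\in S_h^p(0,T),\end{cases}$$ and such that, for every sufficiently smooth $u$, $$\|\partial_tu-\partial_tQ_hu\|_{L^2(0,T)}\le C\,h^p,$$ with a constant $C>0$ depending on $u$ but independent of $h$.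
   Context: $H^2_{0,\bullet}(0,T):=\{u\in H^2(0,T):u(0)=0\}$. $e^{-\bullet/T}$ denotes the function $t\mapsto e^{-t/T}$. ``For every sufficiently smooth $u$'' means: there is an integer $m\ge2$, independent of $u$ and $h$, such that the assertion holds for every $u\in H^2_{0,\bullet}(0,T)\cap C^m([0,T])$. *)

theory Defs
  imports "HOL-Analysis.Analysis" "HOL-Computational_Algebra.Polynomial"
begin

text \<open>Functions on [0,T] are total functions \<^typ>\<open>real \<Rightarrow> real\<close> of which only the values on [0,T]
  matter. The derivative is one-sided at 0 and at T. At points where \<open>f\<close> is not differentiable
  the value is unspecified; below this only concerns the second derivative of a spline at the
  finitely many mesh nodes, which no integral sees.\<close>

definition dt :: "real \<Rightarrow> (real \<Rightarrow> real) \<Rightarrow> real \<Rightarrow> real" where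
  "dt T f t = vector_derivative f (at t within {0..T})"

primrec C_on :: "real \<Rightarrow> nat \<Rightarrow> (real \<Rightarrow> real) \<Rightarrow> bool" where
  "C_on T 0 f \<longleftrightarrow> continuous_on {0..T} f"
| "C_on T (Suc k) f \<longleftrightarrow> f differentiable_on {0..T} \<and> C_on T k (dt T f)"

definition L2 :: "real \<Rightarrow> (real \<Rightarrow> real) set" where
  "L2 T = {f. set_borel_measurable lborel {0<..<T} f \<and>
              set_integrable lborel {0<..<T} (\<lambda>t. (f t)\<^sup>2)}"

definition L2_inner :: "real \<Rightarrow> (real \<Rightarrow> real) \<Rightarrow> (real \<Rightarrow> real) \<Rightarrow> real" where
  "L2_inner T f g = (LINT t:{0<..<T}|lborel. f t * g t)"

definition L2_norm :: "real \<Rightarrow> (real \<Rightarrow> real) \<Rightarrow> real" where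
  "L2_norm T f = sqrt (L2_inner T f f)"

definition test_function :: "real \<Rightarrow> (real \<Rightarrow> real) \<Rightarrow> bool" where
  "test_function T \<phi> \<longleftrightarrow>
     (\<forall>k. (deriv ^^ k) \<phi> differentiable_on UNIV) \<and>
     (\<exists>a b. 0 < a \<and> b < T \<and> (\<forall>t. t \<notin> {a..b} \<longrightarrow> \<phi> t = 0))"

definition weak_deriv :: "real \<Rightarrow> (real \<Rightarrow> real) \<Rightarrow> (real \<Rightarrow> real) \<Rightarrow> bool" where
  "weak_deriv T f g \<longleftrightarrow>
     (\<forall>\<phi>. test_function T \<phi> \<longrightarrow> L2_inner T f (deriv \<phi>) = - L2_inner T g \<phi>)"

text \<open>An element of the Sobolev space \<open>H\<^sup>2(0,T)\<close> is an almost-everywhere class, and by the Sobolev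
  embedding of \<open>H\<^sup>2(0,T)\<close> into \<open>C\<^sup>1([0,T])\<close> it contains a continuously differentiable function,
  unique on [0,T]. We always take that representative: it is the one that gives meaning to
  the point values \<open>u(0)\<close> and \<open>u'(T)\<close>, and its classical derivative is the weak one.\<close>

definition H2 :: "real \<Rightarrow> (real \<Rightarrow> real) set" where
  "H2 T = {u. C_on T 1 u \<and> u \<in> L2 T \<and>
              (\<exists>v\<in>L2 T. weak_deriv T u v \<and> (\<exists>w\<in>L2 T. weak_deriv T v w))}"

definition H2_0 :: "real \<Rightarrow> (real \<Rightarrow> real) set" where
  "H2_0 T = {u \<in> H2 T. u 0 = 0}"

definition spline_space :: "real \<Rightarrow> nat \<Rightarrow> nat \<Rightarrow> (real \<Rightarrow> real) set" where
  "spline_space T p N = {v. C_on T 1 v \<and> v 0 = 0 \<and>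
     (\<forall>j<N. \<exists>q :: real poly. degree q \<le> p \<and>
        (\<forall>t\<in>{real j * (T / real N)..real (Suc j) * (T / real N)}. v t = poly q t))}"

text \<open>Linear, and the identity on the target space. Taken together for the spaces above, these
  conditions also force \<open>Q u = Q v\<close> on [0,T] whenever \<open>u = v\<close> on [0,T].\<close>

definition projection_operator ::
  "real \<Rightarrow> (real \<Rightarrow> real) set \<Rightarrow> (real \<Rightarrow> real) set \<Rightarrow> ((real \<Rightarrow> real) \<Rightarrow> (real \<Rightarrow> real)) \<Rightarrow> bool" where
  "projection_operator T H S Q \<longleftrightarrow>
     (\<forall>u\<in>H. Q u \<in> S) \<and>
     (\<forall>u\<in>H. \<forall>v\<in>H. \<forall>a b. \<forall>t\<in>{0..T}.
        Q (\<lambda>s. a * u s + b * v s) t = a * Q u t + b * Q v t) \<and>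
     (\<forall>w\<in>S. \<forall>t\<in>{0..T}. Q w t = w t)"

end

theory Submission
  imports Defs
begin

text \<open>With \<open>f = u'\<close> and \<open>g = (Q u)'\<close>, the functions \<open>w''\<close> are exactly the discontinuous piecewise
  polynomials of degree \<open>p - 2\<close>, so the problem decouples into cells: on each cell \<open>g\<close> has degree
  \<open>p - 1\<close>, the error \<open>g - f\<close> is orthogonal to degree \<open>p - 2\<close> for the exponential weight, and the value
  of \<open>g\<close> at the right end point is inherited from the next cell. Such a Radau problem is uniquely
  solvable, because a solution vanishing at the right end point is \<open>(1 - s) r\<close> with \<open>r\<close> itself an
  admissible test function.

  Each cell alone produces an error \<open>O(h\<^sup>p)\<close>, and summing \<open>N\<close> of them naively loses one order. But a
  nodal error is passed on to the left with the factor \<open>l(0)\<close>, where \<open>l\<close> is a perturbation of size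
  \<open>O(h)\<close> of the Legendre polynomial of degree \<open>p - 1\<close> on [0,1]. This degree is odd, so that
  \<open>l(0) = -1 + O(h)\<close> and the contributions of neighbouring cells cancel up to \<open>O(h\<^sup>p\<^sup>+\<^sup>1)\<close>: it is here
  that the parity of \<open>p\<close> and the uniformity of the mesh enter.\<close>

subsection \<open>Polynomials orthonormal for a weight on the unit interval\<close>

text \<open>The weight e^(-s/N) changes with the mesh, yet the constants must not. Hence the cell
  estimates are uniform in \<open>\<epsilon>\<close> in [0,1]: there the weight stays between 1/e
  and 1, and equivalence of norms on polynomials is needed only for the fixed weight 1 - s.

  The cancellation is made precise by subtracting the Radau problems of two neighbouring cells.
  Their data differ by f(x) - f(x + h), which a polynomial of degree p - 1 approximates one order
  better than f itself. This yields a two-step recursion for the nodal errors with growth factor 1 +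
  O(1/N) and source O(h^p / N), so that N steps cost only a constant. The price is one derivative
  more than the rate suggests: f needs p + 1 of them, hence u is taken in C^(p+2), which is
  \<open>n + 4\<close> for p = n + 2.

  The conditions on Q u involve only u' on [0,T], which is continuous. They have exactly one
  solution there, so linearity and the projection property follow from uniqueness.\<close>

definition wip :: "(real \<Rightarrow> real) \<Rightarrow> real poly \<Rightarrow> real poly \<Rightarrow> real" where
  "wip w a b = integral {0..1} (\<lambda>x. w x * poly a x * poly b x)"

text \<open>Strict positivity is asked only inside the interval because the Radau weight
  e^(-\<epsilon> s) (1 - s) vanishes at 1.\<close>

definition poly_weight :: "(real \<Rightarrow> real) \<Rightarrow> bool" where
  "poly_weight w \<longleftrightarrow> continuous_on {0..1} w \<and> (\<forall>x\<in>{0..1}. 0 \<le> w x) \<and> (\<forall>x\<in>{0<..<1}. 0 < w x)"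

lemma wip_commute: "wip w a b = wip w b a"
  unfolding wip_def by (simp add: mult_ac)

lemma wip_lincomb_left:
  assumes "continuous_on {0..1} w"
  shows "wip w (smult \<alpha> a + smult \<beta> b) c = \<alpha> * wip w a c + \<beta> * wip w b c"
proof -
  have i: "(\<lambda>x. w x * poly d x * poly c x) integrable_on {0..1}" for d
    using assms by (intro integrable_continuous_interval continuous_intros)
  have "wip w (smult \<alpha> a + smult \<beta> b) c
      = integral {0..1} (\<lambda>x. \<alpha> * (w x * poly a x * poly c x) + \<beta> * (w x * poly b x * poly c x))"
    unfolding wip_def by (simp add: algebra_simps)
  also have "\<dots> = \<alpha> * wip w a c + \<beta> * wip w b c"
    unfolding wip_def by (subst integral_add) (use i in \<open>auto intro!: integrable_on_mult_right\<close>)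
  finally show ?thesis .
qed

lemma wip_sum_left:
  assumes "continuous_on {0..1} w" and "finite A"
  shows "wip w (\<Sum>i\<in>A. smult (f i) (a i)) c = (\<Sum>i\<in>A. f i * wip w (a i) c)"
  using assms(2)
proof (induction A rule: finite_induct)
  case empty
  show ?case by (simp add: wip_def)
next
  case (insert x A)
  then show ?case
    using wip_lincomb_left[OF assms(1), of "f x" "a x" 1 "\<Sum>i\<in>A. smult (f i) (a i)" c] by simp
qed

lemma wip_self_pos:
  assumes w: "poly_weight w" and "a \<noteq> 0"
  shows "0 < wip w a a"
proof -
  let ?f = "\<lambda>x. w x * poly a x * poly a x"
  have c: "continuous_on {0..1} ?f"
    using w unfolding poly_weight_def by (intro continuous_intros) auto
  have nn: "0 \<le> ?f x" if "x \<in> {0..1}" for x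
    using w that unfolding poly_weight_def by (simp add: mult.assoc)
  have "\<not> (\<forall>x\<in>{0..1}. ?f x = 0)"
  proof
    assume *: "\<forall>x\<in>{0..1}. ?f x = 0"
    have "{0<..<1} \<subseteq> {x. poly a x = 0}"
    proof
      fix x :: real assume "x \<in> {0<..<1}"
      then have "w x \<noteq> 0" "?f x = 0" using w * unfolding poly_weight_def by force+
      then show "x \<in> {x. poly a x = 0}" by simp
    qed
    then show False
      using poly_roots_finite[OF \<open>a \<noteq> 0\<close>] infinite_Ioo[of "0::real" 1]
      by (simp add: finite_subset)
  qed
  moreover have "integral {0..1} ?f = 0 \<longleftrightarrow> (\<forall>x\<in>{0..1}. ?f x = 0)"
    using integral_eq_0_iff[OF c] nn by auto
  moreover have "0 \<le> integral {0..1} ?f"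
    by (rule integral_nonneg) (use c nn integrable_continuous_interval in auto)
  ultimately show ?thesis unfolding wip_def by linarith
qed

text \<open>Gram-Schmidt, one degree at a time. The expansion property is carried through the
  induction; it gives both Riesz representation and Parseval's identity below.\<close>

lemma orthonormal_polys:
  assumes w: "poly_weight w"
  shows "\<exists>b. (\<forall>i\<le>n. degree (b i) \<le> n) \<and>
    (\<forall>i\<le>n. \<forall>j\<le>n. wip w (b i) (b j) = (if i = j then 1 else 0)) \<and>
    (\<forall>r. degree r \<le> n \<longrightarrow> r = (\<Sum>i\<le>n. smult (wip w r (b i)) (b i)))"
proof (induction n)
  have c: "continuous_on {0..1} w" using w by (simp add: poly_weight_def)
  case 0
  define k where "k = wip w 1 1"
  have k: "k > 0" unfolding k_def using wip_self_pos[OF w, of 1] by simp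
  have const: "wip w [:x:] [:y:] = x * y * k" for x y
  proof -
    have "wip w [:x:] [:y:] = integral {0..1} (\<lambda>t. (x * y) * (w t * poly 1 t * poly 1 t))"
      unfolding wip_def by (simp add: mult_ac)
    then show ?thesis unfolding k_def wip_def by simp
  qed
  show ?case
  proof (intro exI[of _ "\<lambda>_. [:1 / sqrt k:]"] conjI allI impI)
    fix r :: "real poly" assume "degree r \<le> 0"
    then obtain x where r: "r = [:x:]" by (meson degree_eq_zeroE le_zero_eq)
    show "r = (\<Sum>i\<le>(0::nat). smult (wip w r [:1 / sqrt k:]) [:1 / sqrt k:])"
      using k by (simp add: r const atMost_0)
  qed (use k in \<open>auto simp: const\<close>)
next
  have c: "continuous_on {0..1} w" using w by (simp add: poly_weight_def)
  case (Suc n)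
  then obtain b where b: "\<forall>i\<le>n. degree (b i) \<le> n"
    "\<forall>i\<le>n. \<forall>j\<le>n. wip w (b i) (b j) = (if i = j then 1 else 0)"
    "\<forall>r. degree r \<le> n \<longrightarrow> r = (\<Sum>i\<le>n. smult (wip w r (b i)) (b i))" by blast
  define m where "m = monom (1::real) (Suc n)"
  define P where "P r = (\<Sum>i\<le>n. smult (wip w r (b i)) (b i))" for r
  define z where "z = m - P m"
  have degP: "degree (P r) \<le> n" for r
    unfolding P_def using b(1) by (intro degree_sum_le) (auto intro: order_trans[OF degree_smult_le])
  have z0: "z \<noteq> 0"
  proof
    assume "z = 0"
    then have "degree m \<le> n" using degP[of m] by (simp add: z_def)
    then show False by (simp add: m_def degree_monom_eq)
  qed
  have orthP: "wip w (r - P r) (b j) = 0" if "j \<le> n" for r j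
  proof -
    have "wip w (P r) (b j) = (\<Sum>i\<le>n. wip w r (b i) * wip w (b i) (b j))"
      unfolding P_def by (rule wip_sum_left[OF c]) simp
    also have "\<dots> = (\<Sum>i\<le>n. if i = j then wip w r (b i) else 0)"
      using b(2) that by (intro sum.cong) auto
    also have "\<dots> = wip w r (b j)" using that by simp
    finally show ?thesis
      using wip_lincomb_left[OF c, of 1 r "-1" "P r" "b j"] by simp
  qed
  define k where "k = wip w z z"
  have k: "k > 0" unfolding k_def by (rule wip_self_pos[OF w z0])
  define y where "y = smult (1 / sqrt k) z"
  have sm: "wip w (smult \<alpha> a) d = \<alpha> * wip w a d" for \<alpha> a d
    using wip_lincomb_left[OF c, of \<alpha> a 0 0 d] by simp
  have sm2: "wip w d (smult \<alpha> a) = \<alpha> * wip w d a" for \<alpha> a d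
    using sm wip_commute by metis
  have yy: "wip w y y = 1" using k by (simp add: y_def sm sm2 k_def[symmetric])
  have zb: "wip w z (b j) = 0" if "j \<le> n" for j using orthP[OF that] by (simp add: z_def)
  have yb: "wip w y (b j) = 0" if "j \<le> n" for j using zb[OF that] by (simp add: y_def sm)
  have by': "wip w (b j) y = 0" if "j \<le> n" for j using yb[OF that] by (simp add: wip_commute)
  define B where "B i = (if i \<le> n then b i else y)" for i
  have degz: "degree z \<le> Suc n"
    unfolding z_def m_def using degP[of "monom 1 (Suc n)"]
    by (intro degree_diff_le) (auto simp: degree_monom_eq)
  show ?case
  proof (intro exI[of _ B] conjI allI impI)
    fix i assume "i \<le> Suc n"
    then show "degree (B i) \<le> Suc n"
      using b(1) degz by (auto simp: B_def y_def intro: le_SucI)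
  next
    fix i j assume "i \<le> Suc n" "j \<le> Suc n"
    then show "wip w (B i) (B j) = (if i = j then 1 else 0)"
      using b(2) yy yb by' by (auto simp: B_def)
  next
    fix r :: "real poly" assume r: "degree r \<le> Suc n"
    \<comment> \<open>\<open>z\<close> is monic of degree n + 1, so subtracting this multiple
      removes the top coefficient of \<open>r\<close> and the induction hypothesis applies to the
      rest.\<close>
    define \<alpha> where "\<alpha> = coeff r (Suc n)"
    define r' where "r' = r - smult \<alpha> z"
    have "degree r' \<le> n"
    proof (rule degree_le, intro allI impI)
      fix i assume i: "n < i"
      have "coeff (P m) i = 0" using degP[of m] i by (simp add: coeff_eq_0)
      then show "coeff r' i = 0"
        using i r by (cases "i = Suc n") (auto simp: r'_def z_def m_def \<alpha>_def coeff_eq_0)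
    qed
    then have "r' = (\<Sum>i\<le>n. smult (wip w r' (b i)) (b i))" using b(3) by blast
    moreover have "wip w r' (b i) = wip w r (b i)" if "i \<le> n" for i
      using wip_lincomb_left[OF c, of 1 r "-\<alpha>" z "b i"] zb[OF that] by (simp add: r'_def)
    ultimately have r1: "r' = (\<Sum>i\<le>n. smult (wip w r (b i)) (b i))" by simp
    have "wip w r' z = 0"
      by (subst r1, subst wip_sum_left[OF c]) (auto intro!: sum.neutral simp: zb wip_commute[of w _ z])
    then have "wip w r z = \<alpha> * k"
      using wip_lincomb_left[OF c, of 1 r "-\<alpha>" z z] by (simp add: r'_def k_def)
    then have "smult (wip w r y) y = smult \<alpha> z" using k by (simp add: y_def sm2 field_simps)
    then have "r = r' + smult (wip w r y) y" by (simp add: r'_def)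
    also have "\<dots> = (\<Sum>i\<le>Suc n. smult (wip w r (B i)) (B i))"
      by (subst r1) (simp add: B_def)
    finally show "r = (\<Sum>i\<le>Suc n. smult (wip w r (B i)) (B i))" .
  qed
qed

text \<open>Riesz representation in finite dimension: the representer has the values of the
  functional on the orthonormal basis as its coefficients. It replaces a rank argument in the
  solvability of the Radau problem.\<close>

lemma poly_riesz:
  assumes w: "poly_weight w" and g: "continuous_on {0..1} g"
  shows "\<exists>r. degree r \<le> n \<and>
    (\<forall>\<psi>. degree \<psi> \<le> n \<longrightarrow> wip w r \<psi> = integral {0..1} (\<lambda>x. g x * poly \<psi> x))"
proof -
  have c: "continuous_on {0..1} w" using w by (simp add: poly_weight_def)
  obtain b where b: "\<forall>i\<le>n. degree (b i) \<le> n"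
    "\<forall>i\<le>n. \<forall>j\<le>n. wip w (b i) (b j) = (if i = j then 1 else 0)"
    "\<forall>r. degree r \<le> n \<longrightarrow> r = (\<Sum>i\<le>n. smult (wip w r (b i)) (b i))"
    using orthonormal_polys[OF w] by blast
  define \<Lambda> where "\<Lambda> \<psi> = integral {0..1} (\<lambda>x. g x * poly \<psi> x)" for \<psi>
  define r where "r = (\<Sum>i\<le>n. smult (\<Lambda> (b i)) (b i))"
  have rb: "wip w r (b j) = \<Lambda> (b j)" if "j \<le> n" for j
  proof -
    have "wip w r (b j) = (\<Sum>i\<le>n. \<Lambda> (b i) * wip w (b i) (b j))"
      unfolding r_def by (rule wip_sum_left[OF c]) simp
    also have "\<dots> = (\<Sum>i\<le>n. if i = j then \<Lambda> (b i) else 0)"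
      using b(2) that by (intro sum.cong) auto
    finally show ?thesis using that by simp
  qed
  have "wip w r \<psi> = \<Lambda> \<psi>" if "degree \<psi> \<le> n" for \<psi>
  proof -
    define \<gamma> where "\<gamma> i = wip w \<psi> (b i)" for i
    have \<psi>: "\<psi> = (\<Sum>i\<le>n. smult (\<gamma> i) (b i))" using b(3) that \<gamma>_def by simp
    have "wip w r \<psi> = wip w \<psi> r" by (rule wip_commute)
    also have "\<dots> = (\<Sum>i\<le>n. \<gamma> i * wip w (b i) r)"
      by (subst \<psi>, rule wip_sum_left[OF c]) simp
    also have "\<dots> = (\<Sum>i\<le>n. \<gamma> i * \<Lambda> (b i))"
      using rb by (intro sum.cong) (auto simp: wip_commute[of w _ r])
    also have "\<dots> = integral {0..1} (\<lambda>x. \<Sum>i\<le>n. \<gamma> i * (g x * poly (b i) x))"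
      unfolding \<Lambda>_def by (subst integral_sum)
        (auto intro!: integrable_continuous_interval continuous_intros g)
    also have "\<dots> = \<Lambda> \<psi>"
      unfolding \<Lambda>_def by (subst \<psi>) (simp add: poly_sum sum_distrib_left mult_ac)
    finally show ?thesis .
  qed
  moreover have "degree r \<le> n"
    unfolding r_def using b(1) by (intro degree_sum_le) (auto intro: order_trans[OF degree_smult_le])
  ultimately show ?thesis unfolding \<Lambda>_def by blast
qed

lemma continuous_on_interval_bounded:
  fixes f :: "real \<Rightarrow> real"
  assumes "continuous_on {a..b} f"
  shows "\<exists>B\<ge>0. \<forall>x\<in>{a..b}. \<bar>f x\<bar> \<le> B"
proof -
  have "bounded (f ` {a..b})"
    using assms by (intro compact_imp_bounded compact_continuous_image) auto
  then obtain B where "B > 0" "\<forall>y\<in>f ` {a..b}. norm y \<le> B" by (auto simp: bounded_pos)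
  then show ?thesis by (intro exI[of _ B]) auto
qed

lemma poly_bounded_on_unit: "\<exists>K\<ge>0. \<forall>x\<in>{0..1}. \<bar>poly q x\<bar> \<le> (K::real)"
  by (intro continuous_on_interval_bounded continuous_intros)

text \<open>Equivalence of norms on polynomials of bounded degree: Cauchy-Schwarz in the orthonormal
  expansion, whose squared coefficients sum to \<open>wip w r r\<close>.\<close>

lemma poly_sup_le_wip:
  assumes w: "poly_weight w"
  shows "\<exists>K>0. \<forall>r. degree r \<le> n \<longrightarrow> (\<forall>x\<in>{0..1}. (poly r x)\<^sup>2 \<le> K * wip w r r)"
proof -
  have c: "continuous_on {0..1} w" using w by (simp add: poly_weight_def)
  obtain b where b: "\<forall>i\<le>n. degree (b i) \<le> n"
    "\<forall>i\<le>n. \<forall>j\<le>n. wip w (b i) (b j) = (if i = j then 1 else 0)"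
    "\<forall>r. degree r \<le> n \<longrightarrow> r = (\<Sum>i\<le>n. smult (wip w r (b i)) (b i))"
    using orthonormal_polys[OF w] by blast
  have "\<forall>i. \<exists>k\<ge>0. \<forall>x\<in>{0..1}. \<bar>poly (b i) x\<bar> \<le> k"
    using poly_bounded_on_unit by blast
  then obtain K where K: "\<forall>i. K i \<ge> 0 \<and> (\<forall>x\<in>{0..1}. \<bar>poly (b i) x\<bar> \<le> K i)"
    by (rule choice[THEN exE])
  define M where "M = (\<Sum>i\<le>n. (K i)\<^sup>2) + 1"
  have "(poly r x)\<^sup>2 \<le> M * wip w r r" if r: "degree r \<le> n" and x: "x \<in> {0..1}" for r x
  proof -
    define \<gamma> where "\<gamma> i = wip w r (b i)" for i
    have re: "r = (\<Sum>i\<le>n. smult (\<gamma> i) (b i))" using b(3) r \<gamma>_def by simp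
    have "wip w r r = (\<Sum>i\<le>n. \<gamma> i * wip w (b i) r)"
      by (subst (1) re, rule wip_sum_left[OF c]) simp
    then have ss: "wip w r r = (\<Sum>i\<le>n. (\<gamma> i)\<^sup>2)"
      unfolding \<gamma>_def by (simp add: wip_commute[of w "b _" r] power2_eq_square)
    have "(poly r x)\<^sup>2 = (\<Sum>i\<le>n. \<gamma> i * poly (b i) x)\<^sup>2"
      by (subst re) (simp add: poly_sum)
    also have "\<dots> \<le> (\<Sum>i\<le>n. (\<gamma> i)\<^sup>2) * (\<Sum>i\<le>n. (poly (b i) x)\<^sup>2)"
      by (rule Cauchy_Schwarz_ineq_sum)
    also have "\<dots> \<le> (\<Sum>i\<le>n. (\<gamma> i)\<^sup>2) * M"
    proof (rule mult_left_mono)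
      have "(\<Sum>i\<le>n. (poly (b i) x)\<^sup>2) \<le> (\<Sum>i\<le>n. (K i)\<^sup>2)"
        using K x by (intro sum_mono) (metis abs_ge_zero power2_abs power_mono)
      then show "(\<Sum>i\<le>n. (poly (b i) x)\<^sup>2) \<le> M" by (simp add: M_def)
    qed (simp add: sum_nonneg)
    finally show ?thesis by (simp add: ss mult.commute)
  qed
  moreover have "M > 0" unfolding M_def by (simp add: add_nonneg_pos sum_nonneg)
  ultimately show ?thesis by blast
qed

subsection \<open>The Radau problem on the reference cell\<close>

lemma poly_eqI_on_unit:
  assumes "\<And>x::real. x \<in> {0..1} \<Longrightarrow> poly a x = poly b x"
  shows "a = b"
proof (rule ccontr)
  assume "a \<noteq> b"
  then have "finite {x. poly (a - b) x = 0}" by (intro poly_roots_finite) simp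
  moreover have "{0..1} \<subseteq> {x. poly (a - b) x = 0}" using assms by auto
  ultimately show False by (metis finite_subset infinite_Icc zero_less_one)
qed

text \<open>On the cell number \<open>j\<close> of a mesh of \<open>N\<close> cells the weight \<open>e\<^sup>-\<^sup>t\<^sup>/\<^sup>T\<close> is \<open>e\<^sup>-\<^sup>j\<^sup>/\<^sup>N e\<^sup>-\<^sup>s\<^sup>/\<^sup>N\<close> in the local
  coordinate \<open>s\<close>, so all cells share one reference problem, with \<open>\<epsilon> = 1/N\<close> and \<open>n = p - 2\<close>.\<close>

definition radau :: "real \<Rightarrow> nat \<Rightarrow> (real \<Rightarrow> real) \<Rightarrow> real poly \<Rightarrow> bool" where
  "radau \<epsilon> n F G \<longleftrightarrow> degree G \<le> Suc n \<and>
    (\<forall>\<psi>. degree \<psi> \<le> n \<longrightarrow>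
       integral {0..1} (\<lambda>s. exp (- (\<epsilon> * s)) * (poly G s - F s) * poly \<psi> s) = 0)"

lemma radau_lincomb:
  assumes "radau \<epsilon> n F G" "radau \<epsilon> n F' G'" "continuous_on {0..1} F" "continuous_on {0..1} F'"
  shows "radau \<epsilon> n (\<lambda>s. \<alpha> * F s + \<beta> * F' s) (smult \<alpha> G + smult \<beta> G')"
  unfolding radau_def
proof (intro conjI allI impI)
  show "degree (smult \<alpha> G + smult \<beta> G') \<le> Suc n"
    using assms(1,2) by (intro degree_add_le) (auto simp: radau_def intro: order_trans[OF degree_smult_le])
next
  fix \<psi> :: "real poly" assume d: "degree \<psi> \<le> n"
  let ?I = "\<lambda>F G s. exp (- (\<epsilon> * s)) * (poly G s - F s) * poly \<psi> s"
  have i: "?I F G integrable_on {0..1}" "?I F' G' integrable_on {0..1}"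
    using assms(3,4) by (auto intro!: integrable_continuous_interval continuous_intros)
  have "integral {0..1} (?I (\<lambda>s. \<alpha> * F s + \<beta> * F' s) (smult \<alpha> G + smult \<beta> G'))
     = integral {0..1} (\<lambda>s. \<alpha> * ?I F G s + \<beta> * ?I F' G' s)"
    by (rule integral_cong) (simp add: algebra_simps)
  also have "\<dots> = \<alpha> * integral {0..1} (?I F G) + \<beta> * integral {0..1} (?I F' G')"
    by (subst integral_add) (use i in \<open>auto intro!: integrable_on_mult_right\<close>)
  finally show "integral {0..1} (?I (\<lambda>s. \<alpha> * F s + \<beta> * F' s) (smult \<alpha> G + smult \<beta> G')) = 0"
    using assms(1,2) d by (simp add: radau_def)
qed

lemma radau_poly: "degree \<tau> \<le> Suc n \<Longrightarrow> radau \<epsilon> n (poly \<tau>) \<tau>"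
  by (simp add: radau_def)

lemma poly_weight_radau: "poly_weight (\<lambda>s. exp (- (\<epsilon> * s)) * (1 - s))"
  unfolding poly_weight_def by (auto intro!: continuous_intros)

text \<open>The quotient has degree at most n, hence is an admissible test function. The factor is 1
  - s rather than s - 1 so that it can be absorbed into a nonnegative weight.\<close>

lemma poly_factor_at_1:
  fixes G :: "real poly"
  assumes "degree G \<le> Suc n"
  obtains r where "degree r \<le> n" "G = [:poly G 1:] + [:1, -1:] * r"
proof -
  have "poly (G - [:poly G 1:]) 1 = 0" by simp
  then obtain k where k: "G - [:poly G 1:] = [:-1, 1:] * k"
    unfolding poly_eq_0_iff_dvd dvd_def by auto
  have "degree (G - [:poly G 1:]) \<le> Suc n" using assms by (intro degree_diff_le) auto
  then have "degree k \<le> n"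
    unfolding k by (cases "k = 0") (simp_all add: degree_mult_eq del: mult_pCons_left)
  moreover have "G = [:poly G 1:] + [:1, -1:] * (- k)"
    using k by (simp add: algebra_simps)
  ultimately show ?thesis using that by (metis degree_minus)
qed

text \<open>With G = c + (1 - s) r the conditions say that r represents the functional with density
  e^(-\<epsilon> s) (F - c) for the weight e^(-\<epsilon> s) (1 - s), so Riesz representation
  supplies r.\<close>

lemma radau_exists:
  assumes "continuous_on {0..1} F"
  shows "\<exists>G. radau \<epsilon> n F G \<and> poly G 1 = c"
proof -
  have "continuous_on {0..1} (\<lambda>s. exp (- (\<epsilon> * s)) * (F s - c))"
    using assms by (intro continuous_intros)
  then obtain r where r: "degree r \<le> n"
    "\<And>\<psi>. degree \<psi> \<le> n \<Longrightarrow> wip (\<lambda>s. exp (- (\<epsilon> * s)) * (1 - s)) r \<psi>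
       = integral {0..1} (\<lambda>s. (exp (- (\<epsilon> * s)) * (F s - c)) * poly \<psi> s)"
    using poly_riesz[OF poly_weight_radau] by blast
  define G where "G = [:c:] + [:1, -1:] * r"
  have "degree G \<le> Suc n"
    unfolding G_def using r(1) degree_mult_le[of "[:1, -1:]" r]
    by (intro degree_add_le) (auto simp del: mult_pCons_left)
  moreover have "integral {0..1} (\<lambda>s. exp (- (\<epsilon> * s)) * (poly G s - F s) * poly \<psi> s) = 0"
    if \<psi>: "degree \<psi> \<le> n" for \<psi>
  proof -
    let ?a = "\<lambda>s. exp (- (\<epsilon> * s)) * (1 - s) * poly r s * poly \<psi> s"
    let ?b = "\<lambda>s. exp (- (\<epsilon> * s)) * (F s - c) * poly \<psi> s"
    have i: "?a integrable_on {0..1}" "?b integrable_on {0..1}"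
      using assms by (auto intro!: integrable_continuous_interval continuous_intros)
    have "integral {0..1} (\<lambda>s. exp (- (\<epsilon> * s)) * (poly G s - F s) * poly \<psi> s)
        = integral {0..1} (\<lambda>s. ?a s - ?b s)"
      by (rule integral_cong) (simp add: G_def algebra_simps)
    also have "\<dots> = integral {0..1} ?a - integral {0..1} ?b"
      by (rule integral_diff[OF i])
    also have "\<dots> = 0" using r(2)[OF \<psi>] by (simp add: wip_def)
    finally show ?thesis .
  qed
  ultimately have "radau \<epsilon> n F G" by (simp add: radau_def)
  then show ?thesis by (intro exI[of _ G]) (simp add: G_def)
qed

text \<open>Energy argument: with G = c + (1 - s) r, testing against r itself turns the weighted
  norm of r into an integral of (F - c) r. The constant does not depend on
  \<open>\<epsilon>\<close>, since e^(-\<epsilon> s) is at least 1/e on the unit interval and the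
  norm equivalence is used for the weight 1 - s alone.\<close>

lemma radau_bound:
  "\<exists>C>0. \<forall>\<epsilon>\<in>{0..1}. \<forall>F G M. continuous_on {0..1} F \<longrightarrow> radau \<epsilon> n F G \<longrightarrow>
     (\<forall>s\<in>{0..1}. \<bar>F s\<bar> \<le> M) \<longrightarrow> (\<forall>s\<in>{0..1}. \<bar>poly G s\<bar> \<le> C * (\<bar>poly G 1\<bar> + M))"
proof -
  have w1: "poly_weight (\<lambda>s. 1 - s)"
    unfolding poly_weight_def by (auto intro!: continuous_intros)
  obtain K where K: "K > 0"
    "\<And>r x. degree r \<le> n \<Longrightarrow> x \<in> {0..1} \<Longrightarrow> (poly r x)\<^sup>2 \<le> K * wip (\<lambda>s. 1 - s) r r"
    using poly_sup_le_wip[OF w1] by metis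
  define C where "C = 1 + K * exp 1"
  have "\<bar>poly G x\<bar> \<le> C * (\<bar>poly G 1\<bar> + M)"
    if \<epsilon>: "\<epsilon> \<in> {0..1}" and F: "continuous_on {0..1} F" and G: "radau \<epsilon> n F G"
      and M: "\<forall>s\<in>{0..1}. \<bar>F s\<bar> \<le> M" and x: "x \<in> {0..1}" for \<epsilon> F G M x
  proof -
    define c where "c = poly G 1"
    obtain r where r: "degree r \<le> n" "G = [:c:] + [:1, -1:] * r"
      using poly_factor_at_1 G unfolding c_def radau_def by blast
    let ?w = "\<lambda>s. exp (- (\<epsilon> * s)) * (1 - s)"
    define A where "A = wip ?w r r"
    have M0: "M \<ge> 0" using M[rule_format, of 0] by simp
    have le1: "wip (\<lambda>s. 1 - s) r r \<le> exp 1 * A"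
    proof -
      have *: "1 \<le> exp 1 * exp (- (\<epsilon> * s))" if "s \<in> {0..1}" for s
      proof -
        have "\<epsilon> * s \<le> 1" using \<epsilon> that by (auto intro: mult_le_one)
        then show ?thesis by (simp add: exp_add[symmetric])
      qed
      then have "(1 - s) * poly r s * poly r s \<le> exp 1 * (?w s * poly r s * poly r s)"
        if s: "s \<in> {0..1}" for s
      proof -
        have "1 * ((1 - s) * (poly r s * poly r s))
            \<le> exp 1 * exp (- (\<epsilon> * s)) * ((1 - s) * (poly r s * poly r s))"
          using * [OF s] s by (intro mult_right_mono) auto
        then show ?thesis by (simp add: mult_ac)
      qed
      then have "wip (\<lambda>s. 1 - s) r r \<le> integral {0..1} (\<lambda>s. exp 1 * (?w s * poly r s * poly r s))"
        unfolding wip_def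
        by (intro integral_le integrable_continuous_interval continuous_intros)
      then show ?thesis unfolding A_def wip_def by simp
    qed
    have A0: "A \<ge> 0"
      using wip_self_pos[OF poly_weight_radau, of r \<epsilon>] by (cases "r = 0") (auto simp: A_def wip_def)
    \<comment> \<open>\<open>S\<close> bounds |r| through the energy \<open>A\<close>, while the
      tested equation bounds \<open>A\<close> by (M + |c|) S. Thus S * S is at most a constant times
      S, and one factor cancels.\<close>
    define S where "S = sqrt (K * (exp 1 * A))"
    have S0: "S \<ge> 0" using K A0 by (simp add: S_def)
    have rS: "\<bar>poly r s\<bar> \<le> S" if "s \<in> {0..1}" for s
    proof -
      have "(poly r s)\<^sup>2 \<le> K * (exp 1 * A)"
        using K(2)[OF r(1) that] le1 K(1) mult_left_mono[OF le1, of K] by linarith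
      then show ?thesis unfolding S_def by (simp add: real_le_rsqrt)
    qed
    let ?b = "\<lambda>s. exp (- (\<epsilon> * s)) * (F s - c) * poly r s"
    have ib: "?b integrable_on {0..1}"
      using F by (auto intro!: integrable_continuous_interval continuous_intros)
    have "A = integral {0..1} (\<lambda>s. exp (- (\<epsilon> * s)) * (poly G s - F s) * poly r s + ?b s)"
      unfolding A_def wip_def by (rule integral_cong) (simp add: r(2) algebra_simps)
    also have "\<dots> = integral {0..1} (\<lambda>s. exp (- (\<epsilon> * s)) * (poly G s - F s) * poly r s)
        + integral {0..1} ?b"
      using F by (intro integral_add ib integrable_continuous_interval continuous_intros)
    also have "\<dots> = integral {0..1} ?b" using G r(1) by (simp add: radau_def)
    also have "\<dots> \<le> integral {0..1} (\<lambda>_::real. (M + \<bar>c\<bar>) * S)"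
    proof (rule integral_le)
      show "?b integrable_on {0..1}" by (rule ib)
    next
      fix s :: real assume s: "s \<in> {0..1}"
      have "\<bar>?b s\<bar> = exp (- (\<epsilon> * s)) * (\<bar>F s - c\<bar> * \<bar>poly r s\<bar>)" by (simp add: abs_mult)
      also have "\<dots> \<le> 1 * ((M + \<bar>c\<bar>) * S)"
      proof (rule mult_mono)
        have "\<bar>F s - c\<bar> \<le> M + \<bar>c\<bar>" using M s by (smt (verit))
        then show "\<bar>F s - c\<bar> * \<bar>poly r s\<bar> \<le> (M + \<bar>c\<bar>) * S"
          using rS[OF s] M0 by (intro mult_mono) auto
      qed (use \<epsilon> s in auto)
      finally show "?b s \<le> (M + \<bar>c\<bar>) * S" by simp
    qed (simp add: integrable_const_ivl)
    also have "\<dots> = (M + \<bar>c\<bar>) * S" by simp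
    finally have "A \<le> (M + \<bar>c\<bar>) * S" .
    then have "K * exp 1 * A \<le> K * exp 1 * ((M + \<bar>c\<bar>) * S)"
      using K(1) by (intro mult_left_mono) auto
    moreover have "S * S = K * exp 1 * A" using K(1) A0 by (simp add: S_def)
    ultimately have "S * S \<le> (K * exp 1 * (M + \<bar>c\<bar>)) * S" by (simp add: mult_ac)
    then have S: "S \<le> K * exp 1 * (M + \<bar>c\<bar>)"
    proof (cases "S = 0")
      case True
      then show ?thesis using K(1) M0 by simp
    next
      case False
      then show ?thesis using S0 \<open>S * S \<le> _\<close> by (simp add: mult_le_cancel_right)
    qed
    have "\<bar>poly G x\<bar> = \<bar>c + (1 - x) * poly r x\<bar>" by (simp add: r(2) algebra_simps)
    also have "\<dots> \<le> \<bar>c\<bar> + \<bar>1 - x\<bar> * \<bar>poly r x\<bar>"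
      using abs_triangle_ineq[of c "(1 - x) * poly r x"] by (simp add: abs_mult)
    also have "\<dots> \<le> \<bar>c\<bar> + 1 * S"
      using x rS[OF x] by (intro add_left_mono mult_mono) auto
    also have "\<dots> \<le> C * (\<bar>c\<bar> + M)" using S M0 by (simp add: C_def algebra_simps)
    finally show ?thesis by (simp add: c_def)
  qed
  moreover have "C > 0" using K(1) by (simp add: C_def add_pos_pos)
  ultimately show ?thesis by blast
qed

text \<open>The difference solves the problem with zero data and zero end value, and the stability
  bound makes it vanish.\<close>

lemma radau_unique:
  assumes "\<epsilon> \<in> {0..1}" "continuous_on {0..1} F"
    and "radau \<epsilon> n F G" "radau \<epsilon> n F G'" "poly G 1 = poly G' 1"
  shows "G = G'"
proof -
  obtain C where C: "\<forall>\<epsilon>\<in>{0..1}. \<forall>F G M. continuous_on {0..1} F \<longrightarrow> radau \<epsilon> n F G \<longrightarrow>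
     (\<forall>s\<in>{0..1}. \<bar>F s\<bar> \<le> M) \<longrightarrow> (\<forall>s\<in>{0..1}. \<bar>poly G s\<bar> \<le> C * (\<bar>poly G 1\<bar> + M))"
    using radau_bound by blast
  have "radau \<epsilon> n (\<lambda>s. 0) (G - G')"
    using radau_lincomb[OF assms(3,4,2,2), of 1 "-1"] by simp
  then have "\<forall>s\<in>{0..1}. \<bar>poly (G - G') s\<bar> \<le> C * (\<bar>poly (G - G') 1\<bar> + 0)"
    using C assms(1) by (metis abs_zero continuous_on_const order_refl)
  then show ?thesis using assms(5) by (intro poly_eqI_on_unit) auto
qed

section \<open>The left end value of the homogeneous Radau solution\<close>

lemma integral_reflect_unit:
  fixes f :: "real \<Rightarrow> real"
  assumes "continuous_on {0..1} f"
  shows "integral {0..1} (\<lambda>s. f (1 - s)) = integral {0..1} f"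
proof -
  have "(f has_integral integral {0..1} f) (cbox 0 1)"
    using assms by (simp add: integrable_integral integrable_continuous_interval)
  from has_integral_affinity[OF this, of "-1" 1]
  have "((\<lambda>s. f (1 - s)) has_integral integral {0..1} f) ((\<lambda>x. 1 - x) ` {0..1})"
    by simp
  moreover have "(\<lambda>x. 1 - x) ` {0..1} = {0..1::real}" by simp
  ultimately show ?thesis by (metis integral_unique)
qed

lemma radau_legendre_at_0:
  assumes n: "even n" and l: "radau 0 n (\<lambda>_. 0) l" "poly l 1 = 1"
  shows "poly l 0 = - 1"
proof -
  have dl: "degree l \<le> Suc n"
    and orth: "\<And>\<psi>. degree \<psi> \<le> n \<Longrightarrow> integral {0..1} (\<lambda>s. poly l s * poly \<psi> s) = 0"
    using l(1) by (auto simp: radau_def)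
  have l0: "l \<noteq> 0" using l(2) by auto
  \<comment> \<open>A polynomial of lower degree would be an admissible test function for itself and
    hence zero.\<close>
  have deg: "degree l = Suc n"
  proof (rule ccontr)
    assume "degree l \<noteq> Suc n"
    then have "degree l \<le> n" using dl by simp
    then have "wip (\<lambda>_. 1) l l = 0" using orth by (simp add: wip_def)
    moreover have "poly_weight (\<lambda>_. 1)" by (simp add: poly_weight_def)
    ultimately show False using wip_self_pos l0 by fastforce
  qed
  \<comment> \<open>\<open>l\<close> is orthogonal to \<open>l'\<close>, so \<open>l(0)\<^sup>2 = l(1)\<^sup>2\<close>; the sign is found by reflecting \<open>l\<close> at 1/2.\<close>
  have "((\<lambda>s. 2 * (poly l s * poly (pderiv l) s)) has_integral (poly l 1)\<^sup>2 - (poly l 0)\<^sup>2) {0..1}"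
    by (rule fundamental_theorem_of_calculus)
      (auto intro!: derivative_eq_intros poly_DERIV[THEN DERIV_subset]
        simp: has_real_derivative_iff_has_vector_derivative[symmetric])
  moreover have "integral {0..1} (\<lambda>s. 2 * (poly l s * poly (pderiv l) s)) = 0"
    using orth[of "pderiv l"] deg by (simp add: degree_pderiv)
  ultimately have "(poly l 0)\<^sup>2 = 1" using l(2) by (auto simp: has_integral_iff)
  moreover have "poly l 0 \<noteq> 1"
  proof
    assume one: "poly l 0 = 1"
    \<comment> \<open>If l(0) = 1, the reflection has the same orthogonality and the same value at
      1, so uniqueness gives m = l. But reflecting a polynomial of odd degree changes the sign of
      its leading coefficient.\<close>
    define m where "m = pcompose l [:1, -1:]"
    have "radau 0 n (\<lambda>_. 0) m"
      unfolding radau_def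
    proof (intro conjI allI impI)
      show "degree m \<le> Suc n" by (simp add: m_def degree_pcompose dl)
      fix \<psi> :: "real poly" assume d: "degree \<psi> \<le> n"
      let ?f = "\<lambda>s. poly l s * poly (pcompose \<psi> [:1, -1:]) s"
      have "integral {0..1} (\<lambda>s. poly m s * poly \<psi> s) = integral {0..1} (\<lambda>s. ?f (1 - s))"
        by (simp add: m_def poly_pcompose)
      also have "\<dots> = integral {0..1} ?f"
        by (intro integral_reflect_unit continuous_intros)
      also have "\<dots> = 0" using d by (intro orth) (simp add: degree_pcompose)
      finally show "integral {0..1} (\<lambda>s. exp (- (0 * s)) * (poly m s - 0) * poly \<psi> s) = 0"
        by simp
    qed
    then have "m = l"
      using radau_unique[of 0 "\<lambda>_. 0" n m l] l by (simp add: m_def poly_pcompose one)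
    moreover have "lead_coeff m = - lead_coeff l"
      using lead_coeff_comp[of "[:1, -1:]" l] n deg by (simp add: m_def)
    ultimately show False using l0 by simp
  qed
  ultimately show ?thesis by (auto simp: power2_eq_1_iff)
qed

text \<open>Perturbation of the case \<open>\<epsilon>\<close> = 0: \<open>l - l0\<close> vanishes
  at 1 and solves a Radau problem whose data are O(\<epsilon>), so the stability bound applies to
  it.\<close>

lemma radau_homogeneous_at_0:
  assumes "even n"
  shows "\<exists>C>0. \<forall>\<epsilon>\<in>{0..1}. \<forall>l. radau \<epsilon> n (\<lambda>_. 0) l \<longrightarrow> poly l 1 = 1 \<longrightarrow> \<bar>poly l 0 + 1\<bar> \<le> C * \<epsilon>"
proof -
  obtain C where C: "C > 0" "\<forall>\<epsilon>\<in>{0..1}. \<forall>F G M. continuous_on {0..1} F \<longrightarrow> radau \<epsilon> n F G \<longrightarrow>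
     (\<forall>s\<in>{0..1}. \<bar>F s\<bar> \<le> M) \<longrightarrow> (\<forall>s\<in>{0..1}. \<bar>poly G s\<bar> \<le> C * (\<bar>poly G 1\<bar> + M))"
    using radau_bound by blast
  obtain l0 where l0: "radau 0 n (\<lambda>_. 0) l0" "poly l0 1 = 1"
    using radau_exists[of "\<lambda>_. 0" 0 n 1] by auto
  have l00: "poly l0 0 = - 1" by (rule radau_legendre_at_0[OF assms l0])
  obtain K where K: "K \<ge> 0" "\<forall>s\<in>{0..1}. \<bar>poly l0 s\<bar> \<le> K" using poly_bounded_on_unit by blast
  have "\<bar>poly l 0 + 1\<bar> \<le> (C * (3 * K + 1)) * \<epsilon>"
    if \<epsilon>: "\<epsilon> \<in> {0..1}" and l: "radau \<epsilon> n (\<lambda>_. 0) l" "poly l 1 = 1" for \<epsilon> l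
  proof -
    \<comment> \<open>Chosen so that e^(-\<epsilon> s) ((l - l0) - F) = e^(-\<epsilon> s) l - l0, a
      difference of two functions orthogonal to degree n.\<close>
    define F where "F s = (exp (\<epsilon> * s) - 1) * poly l0 s" for s
    have cF: "continuous_on {0..1} F" unfolding F_def by (intro continuous_intros)
    have r: "radau \<epsilon> n F (l - l0)"
      unfolding radau_def
    proof (intro conjI allI impI)
      show "degree (l - l0) \<le> Suc n" using l l0 by (intro degree_diff_le) (auto simp: radau_def)
      fix \<psi> :: "real poly" assume d: "degree \<psi> \<le> n"
      have "integral {0..1} (\<lambda>s. exp (- (\<epsilon> * s)) * (poly (l - l0) s - F s) * poly \<psi> s)
        = integral {0..1} (\<lambda>s. exp (- (\<epsilon> * s)) * poly l s * poly \<psi> s - poly l0 s * poly \<psi> s)"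
        by (rule integral_cong) (simp add: F_def exp_minus field_simps)
      also have "\<dots> = integral {0..1} (\<lambda>s. exp (- (\<epsilon> * s)) * poly l s * poly \<psi> s)
          - integral {0..1} (\<lambda>s. poly l0 s * poly \<psi> s)"
        by (intro integral_diff integrable_continuous_interval continuous_intros)
      also have "\<dots> = 0" using l(1) l0(1) d by (simp add: radau_def)
      finally show "integral {0..1} (\<lambda>s. exp (- (\<epsilon> * s)) * (poly (l - l0) s - F s) * poly \<psi> s) = 0" .
    qed
    have "\<bar>F s\<bar> \<le> 3 * \<epsilon> * K" if s: "s \<in> {0..1}" for s
    proof -
      have es: "0 \<le> \<epsilon> * s" "\<epsilon> * s \<le> \<epsilon>" "\<epsilon> * s \<le> 1" using \<epsilon> s by (auto simp: mult_left_le mult_le_one)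
      have "exp (\<epsilon> * s) \<le> 1 + \<epsilon> * s + (\<epsilon> * s)\<^sup>2" using es by (intro exp_bound)
      moreover have "(\<epsilon> * s)\<^sup>2 \<le> \<epsilon> * s" using es by (simp add: power2_eq_square mult_left_le)
      ultimately have "\<bar>exp (\<epsilon> * s) - 1\<bar> \<le> 3 * \<epsilon>" using es \<epsilon> by auto
      then show ?thesis
        unfolding F_def abs_mult using K s by (intro mult_mono) auto
    qed
    then have "\<bar>poly (l - l0) 0\<bar> \<le> C * (\<bar>poly (l - l0) 1\<bar> + 3 * \<epsilon> * K)"
      using C(2) \<epsilon> cF r by (metis atLeastAtMost_iff order_refl zero_le_one)
    then have "\<bar>poly l 0 + 1\<bar> \<le> C * (3 * \<epsilon> * K)" using l(2) l0(2) l00 by simp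
    also have "\<dots> \<le> (C * (3 * K + 1)) * \<epsilon>" using C(1) \<epsilon> by (simp add: algebra_simps)
    finally show ?thesis .
  qed
  moreover have "C * (3 * K + 1) > 0" using C(1) K(1) by simp
  ultimately show ?thesis by blast
qed

subsection \<open>Error propagation through the mesh\<close>

text \<open>The claimed bound is nondecreasing in k, so its value at k - 1 dominates both
  predecessors. Enlarging \<open>\<delta>\<close> to \<open>\<beta> ^ k * \<delta>\<close> in each
  step keeps the closed form.\<close>

lemma two_step_gronwall:
  fixes a :: "nat \<Rightarrow> real"
  assumes "a 0 \<le> A" "a 1 \<le> A" "0 \<le> A" "1 \<le> \<beta>" "0 \<le> \<delta>"
    and step: "\<And>k. k + 2 \<le> N \<Longrightarrow> a (k + 2) \<le> \<beta> * max (a k) (a (k + 1)) + \<delta>"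
  shows "k \<le> N \<Longrightarrow> a k \<le> \<beta> ^ k * (A + real k * \<delta>)"
proof (induction k rule: less_induct)
  case (less k)
  consider "k = 0" | "k = 1" | j where "k = j + 2"
    by (metis One_nat_def Suc_eq_plus1 add_2_eq_Suc' not0_implies_Suc)
  then show ?case
  proof cases
    case 1
    then show ?thesis using assms by simp
  next
    case 2
    have "A \<le> \<beta> * (A + \<delta>)" using assms mult_mono[of 1 \<beta> A "A + \<delta>"] by simp
    then show ?thesis using 2 assms(2) by simp
  next
    case (3 j)
    let ?R = "\<beta> ^ (j + 1) * (A + real (j + 1) * \<delta>)"
    have "a j \<le> \<beta> ^ j * (A + real j * \<delta>)" using less 3 by simp
    also have "\<dots> \<le> ?R"
      using assms by (intro mult_mono power_increasing add_left_mono mult_right_mono) auto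
    finally have "a j \<le> ?R" .
    moreover have "a (j + 1) \<le> ?R" using less.IH[of "j + 1"] less.prems 3 by (simp del: power_Suc)
    ultimately have "max (a j) (a (j + 1)) \<le> ?R" by simp
    then have "a (j + 2) \<le> \<beta> * ?R + \<delta>"
      using step[of j] less.prems 3 assms(4) mult_left_mono[of "max (a j) (a (j + 1))" ?R \<beta>] by linarith
    also have "\<dots> \<le> \<beta> * ?R + \<beta> ^ (j + 2) * \<delta>"
      using assms mult_right_mono[of 1 "\<beta> ^ (j + 2)" \<delta>] one_le_power[of \<beta> "j + 2"] by simp
    also have "\<dots> = \<beta> ^ k * (A + real k * \<delta>)" using 3 by (simp add: algebra_simps)
    finally show ?thesis using 3 by simp
  qed
qed

text \<open>Quasi-optimality: the Radau problem reproduces polynomials of degree n + 1, so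
  \<open>\<tau>\<close> may be subtracted from data and solution before the stability bound is
  applied. Replacing \<open>\<tau>\<close> by F at the end point and at s costs further multiples of
  \<open>A\<close>.\<close>

lemma radau_error:
  "\<exists>C>0. \<forall>\<epsilon>\<in>{0..1}. \<forall>F G \<tau> A. continuous_on {0..1} F \<longrightarrow> radau \<epsilon> n F G \<longrightarrow>
     degree \<tau> \<le> Suc n \<longrightarrow> (\<forall>s\<in>{0..1}. \<bar>F s - poly \<tau> s\<bar> \<le> A) \<longrightarrow>
     (\<forall>s\<in>{0..1}. \<bar>poly G s - F s\<bar> \<le> C * (\<bar>poly G 1 - F 1\<bar> + A))"
proof -
  obtain C where C: "C > 0" "\<forall>\<epsilon>\<in>{0..1}. \<forall>F G M. continuous_on {0..1} F \<longrightarrow> radau \<epsilon> n F G \<longrightarrow>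
     (\<forall>s\<in>{0..1}. \<bar>F s\<bar> \<le> M) \<longrightarrow> (\<forall>s\<in>{0..1}. \<bar>poly G s\<bar> \<le> C * (\<bar>poly G 1\<bar> + M))"
    using radau_bound by blast
  have "\<bar>poly G s - F s\<bar> \<le> (2 * C + 1) * (\<bar>poly G 1 - F 1\<bar> + A)"
    if \<epsilon>: "\<epsilon> \<in> {0..1}" and F: "continuous_on {0..1} F" and G: "radau \<epsilon> n F G"
      and d: "degree \<tau> \<le> Suc n" and A: "\<forall>s\<in>{0..1}. \<bar>F s - poly \<tau> s\<bar> \<le> A" and s: "s \<in> {0..1}"
    for \<epsilon> F G \<tau> A s
  proof -
    have "radau \<epsilon> n (\<lambda>s. F s - poly \<tau> s) (G - \<tau>)"
      using radau_lincomb[OF G radau_poly[OF d] F, of 1 "-1"] by (simp add: continuous_on_poly)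
    moreover have "continuous_on {0..1} (\<lambda>s. F s - poly \<tau> s)"
      using F by (intro continuous_intros)
    ultimately have "\<bar>poly (G - \<tau>) s\<bar> \<le> C * (\<bar>poly (G - \<tau>) 1\<bar> + A)"
      using C(2) \<epsilon> A s by blast
    moreover have "\<bar>F 1 - poly \<tau> 1\<bar> \<le> A" "\<bar>F s - poly \<tau> s\<bar> \<le> A" using A s by auto
    moreover from this have "C * (\<bar>poly (G - \<tau>) 1\<bar> + A) \<le> C * (\<bar>poly G 1 - F 1\<bar> + 2 * A)"
      using C(1) by (intro mult_left_mono) auto
    moreover have "0 \<le> C * \<bar>poly G 1 - F 1\<bar>" using C(1) by simp
    moreover have "\<bar>poly G s - F s\<bar> \<le> \<bar>poly (G - \<tau>) s\<bar> + \<bar>F s - poly \<tau> s\<bar>" by simp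
    moreover have "(2 * C + 1) * (\<bar>poly G 1 - F 1\<bar> + A)
        = C * (\<bar>poly G 1 - F 1\<bar> + 2 * A) + C * \<bar>poly G 1 - F 1\<bar> + \<bar>poly G 1 - F 1\<bar> + A"
      by (simp add: algebra_simps)
    ultimately show ?thesis by linarith
  qed
  moreover have "2 * C + 1 > 0" using C(1) by simp
  ultimately show ?thesis by blast
qed

text \<open>A chain of cell problems detached from splines: \<open>A\<close> stands for h^p, and the
  last hypothesis is the gain of one order for neighbouring data. That gain is what N transfers
  across cells consume, so the final bound carries no factor N.\<close>

lemma radau_chain_error:
  assumes "even n"
  shows "\<exists>C>0. \<forall>N\<ge>1. \<forall>F G A.
    (\<forall>j<N. continuous_on {0..1} (F j) \<and> radau (1 / real N) n (F j) (G j)) \<longrightarrow>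
    (\<forall>j. Suc j < N \<longrightarrow> F j 1 = F (Suc j) 0 \<and> poly (G j) 1 = poly (G (Suc j)) 0) \<longrightarrow>
    poly (G (N - 1)) 1 = F (N - 1) 1 \<longrightarrow>
    (\<forall>j<N. \<exists>\<tau>. degree \<tau> \<le> Suc n \<and> (\<forall>s\<in>{0..1}. \<bar>F j s - poly \<tau> s\<bar> \<le> A)) \<longrightarrow>
    (\<forall>j. Suc j < N \<longrightarrow> (\<exists>\<tau>. degree \<tau> \<le> Suc n \<and>
        (\<forall>s\<in>{0..1}. \<bar>(F j s - F (Suc j) s) - poly \<tau> s\<bar> \<le> A / real N))) \<longrightarrow>
    (\<forall>j<N. \<forall>s\<in>{0..1}. \<bar>poly (G j) s - F j s\<bar> \<le> C * A)"
proof -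
  obtain C where C: "C > 0" "\<forall>\<epsilon>\<in>{0..1}. \<forall>F G \<tau> A. continuous_on {0..1} F \<longrightarrow> radau \<epsilon> n F G \<longrightarrow>
     degree \<tau> \<le> Suc n \<longrightarrow> (\<forall>s\<in>{0..1}. \<bar>F s - poly \<tau> s\<bar> \<le> A) \<longrightarrow>
     (\<forall>s\<in>{0..1}. \<bar>poly G s - F s\<bar> \<le> C * (\<bar>poly G 1 - F 1\<bar> + A))"
    using radau_error by blast
  obtain D where D: "D > 0" "\<forall>\<epsilon>\<in>{0..1}. \<forall>l. radau \<epsilon> n (\<lambda>_. 0) l \<longrightarrow> poly l 1 = 1 \<longrightarrow>
      \<bar>poly l 0 + 1\<bar> \<le> D * \<epsilon>"
    using radau_homogeneous_at_0[OF assms] by blast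
  define C' where "C' = C * (2 * C * exp (2 * D) + 1)"
  have "\<bar>poly (G j) s - F j s\<bar> \<le> C' * A"
    if N: "N \<ge> 1"
      and FG: "\<forall>j<N. continuous_on {0..1} (F j) \<and> radau (1 / real N) n (F j) (G j)"
      and cont: "\<forall>j. Suc j < N \<longrightarrow> F j 1 = F (Suc j) 0 \<and> poly (G j) 1 = poly (G (Suc j)) 0"
      and last: "poly (G (N - 1)) 1 = F (N - 1) 1"
      and apx: "\<forall>j<N. \<exists>\<tau>. degree \<tau> \<le> Suc n \<and> (\<forall>s\<in>{0..1}. \<bar>F j s - poly \<tau> s\<bar> \<le> A)"
      and apx2: "\<forall>j. Suc j < N \<longrightarrow> (\<exists>\<tau>. degree \<tau> \<le> Suc n \<and>
        (\<forall>s\<in>{0..1}. \<bar>(F j s - F (Suc j) s) - poly \<tau> s\<bar> \<le> A / real N))"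
      and j: "j < N" and s: "s \<in> {0..1}"
    for N and F :: "nat \<Rightarrow> real \<Rightarrow> real" and G A j s
  proof -
    define \<epsilon> where "\<epsilon> = 1 / real N"
    have \<epsilon>: "\<epsilon> \<in> {0..1}" "\<epsilon> \<ge> 0" using N by (auto simp: \<epsilon>_def)
    \<comment> \<open>nodal errors, counted from the right end\<close>
    define E where "E k = (if k = 0 then 0 else poly (G (N - k)) 0 - F (N - k) 0)" for k
    have E1: "poly (G (N - Suc k)) 1 - F (N - Suc k) 1 = E k" if k: "k < N" for k
    proof (cases "k = 0")
      case True
      then show ?thesis using last by (simp add: E_def)
    next
      case False
      then have "Suc (N - Suc k) = N - k" "Suc (N - Suc k) < N" using k by auto
      then show ?thesis using cont False by (metis E_def)
    qed
    have A0: "A \<ge> 0"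
      using apx j by (metis abs_ge_zero atLeastAtMost_iff order_refl order_trans zero_le_one)
    have loc: "\<bar>poly (G i) t - F i t\<bar> \<le> C * (\<bar>poly (G i) 1 - F i 1\<bar> + A)"
      if "i < N" "t \<in> {0..1}" for i t
    proof -
      obtain \<tau> where "degree \<tau> \<le> Suc n" "\<forall>s\<in>{0..1}. \<bar>F i s - poly \<tau> s\<bar> \<le> A"
        using apx \<open>i < N\<close> by blast
      then show ?thesis
        using C(2) FG \<epsilon>(1) that unfolding \<epsilon>_def by blast
    qed
    obtain l where l: "radau \<epsilon> n (\<lambda>_. 0) l" "poly l 1 = 1"
      using radau_exists[of "\<lambda>_. 0" \<epsilon> n 1] by auto
    \<comment> \<open>The difference of the problems on two neighbouring cells has data of size \<open>A/N\<close>; since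
      \<open>l(0) = \<eta> - 1\<close>, it gives \<open>E (k + 2) = E k + \<eta> (E (k + 1) - E k) + O(A/N)\<close>.\<close>
    have step: "\<bar>E (k + 2)\<bar> \<le> (1 + 2 * D * \<epsilon>) * max \<bar>E k\<bar> \<bar>E (k + 1)\<bar> + C * A * \<epsilon>"
      if k: "k + 2 \<le> N" for k
    proof -
      define i where "i = N - (k + 2)"
      have i: "Suc i < N" "N - Suc k = Suc i" "N - Suc (Suc k) = i"
        using k by (auto simp: i_def)
      have Ek: "E (k + 2) = poly (G i) 0 - F i 0" "E (k + 1) = poly (G (Suc i)) 0 - F (Suc i) 0"
        using i by (simp_all add: E_def)
      have cF: "continuous_on {0..1} (F i)" "continuous_on {0..1} (F (Suc i))" using FG i by auto
      have rG: "radau \<epsilon> n (F i) (G i)" "radau \<epsilon> n (F (Suc i)) (G (Suc i))"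
        using FG i by (auto simp: \<epsilon>_def)
      define d where "d = E (k + 1) - E k"
      \<comment> \<open>Subtracting d l removes the mismatch at the right end: \<open>?H\<close>
        takes there exactly the value of its data, and only the approximation error A/N
        remains.\<close>
      let ?H = "G i - G (Suc i) - smult d l"
      have "radau \<epsilon> n (\<lambda>s. F i s - F (Suc i) s) (G i - G (Suc i))"
        using radau_lincomb[OF rG cF, of 1 "-1"] by simp
      from radau_lincomb[OF this l(1), of 1 "- d"]
      have H: "radau \<epsilon> n (\<lambda>s. F i s - F (Suc i) s) ?H"
        using cF by (simp add: continuous_on_diff)
      have H1: "poly ?H 1 = F i 1 - F (Suc i) 1"
        using E1[of k] E1[of "Suc k"] i k l(2) by (simp add: d_def)
      obtain \<tau> where "degree \<tau> \<le> Suc n"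
        "\<forall>s\<in>{0..1}. \<bar>(F i s - F (Suc i) s) - poly \<tau> s\<bar> \<le> A / real N"
        using apx2 i by blast
      moreover have "continuous_on {0..1} (\<lambda>s. F i s - F (Suc i) s)"
        using cF by (intro continuous_intros)
      ultimately have "\<forall>s\<in>{0..1}. \<bar>poly ?H s - (F i s - F (Suc i) s)\<bar>
          \<le> C * (\<bar>poly ?H 1 - (F i 1 - F (Suc i) 1)\<bar> + A / real N)"
        using C(2) H \<epsilon>(1) by blast
      then have "\<bar>poly ?H 0 - (F i 0 - F (Suc i) 0)\<bar>
          \<le> C * (\<bar>poly ?H 1 - (F i 1 - F (Suc i) 1)\<bar> + A / real N)"
        by (rule bspec) simp
      then have "\<bar>poly ?H 0 - (F i 0 - F (Suc i) 0)\<bar> \<le> C * (A / real N)"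
        unfolding H1 by simp
      moreover have "poly ?H 0 - (F i 0 - F (Suc i) 0) = E (k + 2) - E (k + 1) - d * poly l 0"
        unfolding Ek by simp
      ultimately have 1: "\<bar>E (k + 2) - E (k + 1) - d * poly l 0\<bar> \<le> C * A * \<epsilon>"
        by (simp add: \<epsilon>_def)
      define \<eta> where "\<eta> = poly l 0 + 1"
      have \<eta>: "\<bar>\<eta>\<bar> \<le> D * \<epsilon>" using D(2) \<epsilon>(1) l by (simp add: \<eta>_def)
      let ?m = "max \<bar>E k\<bar> \<bar>E (k + 1)\<bar>"
      have "\<bar>d * \<eta>\<bar> \<le> (2 * ?m) * (D * \<epsilon>)"
        unfolding abs_mult using \<eta> d_def by (intro mult_mono) auto
      moreover have "E (k + 2) = (E (k + 2) - E (k + 1) - d * poly l 0) + E k + d * \<eta>"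
        by (simp add: \<eta>_def d_def algebra_simps)
      ultimately have "\<bar>E (k + 2)\<bar> \<le> C * A * \<epsilon> + ?m + (2 * ?m) * (D * \<epsilon>)"
        using 1 by linarith
      then show ?thesis by (simp add: algebra_simps)
    qed
    have "\<bar>E 1\<bar> \<le> C * A"
    proof -
      have "\<bar>poly (G (N - 1)) 0 - F (N - 1) 0\<bar> \<le> C * (\<bar>poly (G (N - 1)) 1 - F (N - 1) 1\<bar> + A)"
        by (rule loc) (use N in auto)
      then show ?thesis using last by (simp add: E_def)
    qed
    moreover have "\<bar>E 0\<bar> \<le> C * A" "0 \<le> C * A" "0 \<le> C * A * \<epsilon>" "1 \<le> 1 + 2 * D * \<epsilon>"
      using A0 C(1) D(1) \<epsilon>(2) by (auto simp: E_def)
    ultimately have gr: "\<bar>E k\<bar> \<le> (1 + 2 * D * \<epsilon>) ^ k * (C * A + real k * (C * A * \<epsilon>))"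
      if "k \<le> N" for k
      using two_step_gronwall[of "\<lambda>k. \<bar>E k\<bar>" "C * A" "1 + 2 * D * \<epsilon>" "C * A * \<epsilon>" N k] step that
      by blast
    \<comment> \<open>For k at most N, k \<epsilon> is at most 1: the growth factors multiply to at
      most e^(2D), and the sources C A \<epsilon> add up to at most C A.\<close>
    have nodes: "\<bar>E k\<bar> \<le> exp (2 * D) * (2 * (C * A))" if k: "k \<le> N" for k
    proof -
      have "(1 + 2 * D * \<epsilon>) ^ k \<le> exp (2 * D * \<epsilon>) ^ k"
        using D(1) \<epsilon>(2) by (intro power_mono) (auto intro: exp_ge_add_one_self)
      also have "\<dots> = exp (2 * D * (real k * \<epsilon>))" by (simp add: exp_of_nat_mult[symmetric] mult_ac)
      also have "\<dots> \<le> exp (2 * D)"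
        using k N D(1) mult_left_mono[of "real k * \<epsilon>" 1 "2 * D"] by (simp add: \<epsilon>_def)
      finally have 1: "(1 + 2 * D * \<epsilon>) ^ k \<le> exp (2 * D)" .
      have "(C * A) * (real k * \<epsilon>) \<le> (C * A) * 1"
        using k N A0 C(1) by (intro mult_left_mono) (auto simp: \<epsilon>_def)
      then have 2: "C * A + real k * (C * A * \<epsilon>) \<le> 2 * (C * A)" by (simp add: mult_ac)
      show ?thesis
        by (rule order_trans[OF gr[OF k]], rule mult_mono[OF 1 2])
          (use A0 C(1) \<epsilon>(2) in auto)
    qed
    have "\<bar>poly (G j) s - F j s\<bar> \<le> C * (\<bar>poly (G j) 1 - F j 1\<bar> + A)" by (rule loc[OF j s])
    also have "poly (G j) 1 - F j 1 = E (N - Suc j)" using E1[of "N - Suc j"] j by simp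
    also have "C * (\<bar>E (N - Suc j)\<bar> + A) \<le> C * (exp (2 * D) * (2 * (C * A)) + A)"
      using nodes[of "N - Suc j"] C(1) by (intro mult_left_mono) auto
    also have "\<dots> = C' * A" by (simp add: C'_def algebra_simps)
    finally show ?thesis .
  qed
  moreover have "C' > 0" using C(1) by (simp add: C'_def add_pos_pos)
  ultimately show ?thesis by blast
qed

section \<open>Taylor approximation on the cells of the mesh\<close>

lemma mesh_interval:
  assumes "0 < T" "j < N" "s \<in> {0..1}"
  shows "(real j + s) * (T / real N) \<in> {0..T}"
proof -
  have "real j + s \<le> real N" using assms(2,3) by (simp add: nat_less_real_le)
  then have "(real j + s) * (T / real N) \<le> real N * (T / real N)"
    using assms(1) by (intro mult_right_mono) auto
  then show ?thesis using assms by auto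
qed

lemma taylor_poly_unit:
  fixes g :: "nat \<Rightarrow> real \<Rightarrow> real"
  assumes der: "\<And>i s. s \<in> {0..1} \<Longrightarrow> i \<le> n \<Longrightarrow> (g i has_real_derivative g (Suc i) s) (at s within {0..1})"
    and B: "\<And>s. s \<in> {0..1} \<Longrightarrow> \<bar>g (Suc n) s\<bar> \<le> M"
  shows "\<exists>\<tau>. degree \<tau> \<le> n \<and> (\<forall>s\<in>{0..1}. \<bar>g 0 s - poly \<tau> s\<bar> \<le> M)"
proof (intro exI conjI ballI)
  let ?\<tau> = "\<Sum>i\<le>n. monom (g i 0 / fact i) i"
  show "degree ?\<tau> \<le> n" by (intro degree_sum_le) (auto intro: order_trans[OF degree_monom_le])
  fix s :: real assume s: "s \<in> {0..1}"
  have M: "0 \<le> M" using B[OF s] by linarith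
  have "norm (g 0 s - (\<Sum>i\<le>n. g i 0 * (s - 0) ^ i / fact i)) \<le> M * norm (s - 0) ^ Suc n / fact n"
    by (rule field_Taylor[of "{0..1}"]) (use der B s in auto)
  also have "\<dots> \<le> M * 1 / 1"
    using M s by (intro frac_le mult_left_mono) (auto simp: power_le_one fact_ge_1 simp del: power_Suc)
  finally show "\<bar>g 0 s - poly ?\<tau> s\<bar> \<le> M" by (simp add: poly_sum poly_monom)
qed

text \<open>In the local coordinate the i-th derivative carries a factor h^i. For neighbouring
  cells, corresponding points lie exactly h apart, so the n-th derivatives differ by at most B h.
  This is the extra order, paid for by a bound on the derivative of order n + 1.\<close>

lemma mesh_taylor:
  fixes D :: "nat \<Rightarrow> real \<Rightarrow> real"
  assumes T: "0 < T" and N: "N \<ge> 1"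
    and der: "\<And>i x. x \<in> {0..T} \<Longrightarrow> i \<le> n \<Longrightarrow> (D i has_real_derivative D (Suc i) x) (at x within {0..T})"
    and B: "\<And>x. x \<in> {0..T} \<Longrightarrow> \<bar>D n x\<bar> \<le> B" "\<And>x. x \<in> {0..T} \<Longrightarrow> \<bar>D (Suc n) x\<bar> \<le> B"
    and n: "n > 0"
  defines "h \<equiv> T / real N"
  shows "j < N \<Longrightarrow> \<exists>\<tau>. degree \<tau> < n \<and>
      (\<forall>s\<in>{0..1}. \<bar>D 0 ((real j + s) * h) - poly \<tau> s\<bar> \<le> h ^ n * B)"
    and "Suc j < N \<Longrightarrow> \<exists>\<tau>. degree \<tau> < n \<and>
      (\<forall>s\<in>{0..1}. \<bar>(D 0 ((real j + s) * h) - D 0 ((real (Suc j) + s) * h)) - poly \<tau> s\<bar>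
         \<le> h ^ n * (B * h))"
proof -
  obtain m where m: "n = Suc m" using n by (cases n) auto
  have h: "h > 0" using T N by (simp add: h_def)
  have inT: "(real j + s) * h \<in> {0..T}" if "j < N" "s \<in> {0..1}" for j s
    unfolding h_def by (rule mesh_interval[OF T that])
  have chain: "((\<lambda>s. h ^ i * D i ((real j + s) * h)) has_real_derivative
      h ^ Suc i * D (Suc i) ((real j + s) * h)) (at s within {0..1})"
    if "j < N" "s \<in> {0..1}" "i \<le> m" for i j s
  proof -
    have "(D i has_real_derivative D (Suc i) ((real j + s) * h))
        (at ((real j + s) * h) within (\<lambda>s. (real j + s) * h) ` {0..1})"
      by (rule has_field_derivative_subset[OF der]) (use inT that m in auto)
    moreover have "((\<lambda>s. (real j + s) * h) has_real_derivative h) (at s within {0..1})"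
      by (auto intro!: derivative_eq_intros)
    ultimately have "((D i \<circ> (\<lambda>s. (real j + s) * h)) has_real_derivative
        D (Suc i) ((real j + s) * h) * h) (at s within {0..1})"
      by (rule DERIV_image_chain)
    then have "((\<lambda>s. h ^ i * D i ((real j + s) * h)) has_real_derivative
        h ^ i * (D (Suc i) ((real j + s) * h) * h)) (at s within {0..1})"
      unfolding o_def by (rule DERIV_cmult)
    then show ?thesis by (simp add: mult_ac)
  qed
  {
    assume j: "j < N"
    let ?g = "\<lambda>i s. h ^ i * D i ((real j + s) * h)"
    have "\<exists>\<tau>. degree \<tau> \<le> m \<and> (\<forall>s\<in>{0..1}. \<bar>?g 0 s - poly \<tau> s\<bar> \<le> h ^ n * B)"
    proof (rule taylor_poly_unit)
      fix s :: real assume s: "s \<in> {0..1}"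
      show "\<bar>h ^ Suc m * D (Suc m) ((real j + s) * h)\<bar> \<le> h ^ n * B"
        using B(1)[OF inT[OF j s]] h by (simp add: m abs_mult mult_left_mono)
    qed (rule chain[OF j])
    then show "\<exists>\<tau>. degree \<tau> < n \<and>
      (\<forall>s\<in>{0..1}. \<bar>D 0 ((real j + s) * h) - poly \<tau> s\<bar> \<le> h ^ n * B)"
      by (simp add: m less_Suc_eq_le)
  }
  {
    assume j: "Suc j < N"
    let ?g = "\<lambda>i s. h ^ i * D i ((real j + s) * h) - h ^ i * D i ((real (Suc j) + s) * h)"
    have "\<exists>\<tau>. degree \<tau> \<le> m \<and> (\<forall>s\<in>{0..1}. \<bar>?g 0 s - poly \<tau> s\<bar> \<le> h ^ n * (B * h))"
    proof (rule taylor_poly_unit)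
      fix i s assume "s \<in> {0..1::real}" "i \<le> m"
      then show "(?g i has_real_derivative ?g (Suc i) s) (at s within {0..1})"
        using j by (intro DERIV_diff chain) auto
    next
      fix s :: real assume s: "s \<in> {0..1}"
      let ?x = "(real j + s) * h" and ?y = "(real (Suc j) + s) * h"
      have xy: "?x \<in> {0..T}" "?y \<in> {0..T}"
        by (rule inT[OF Suc_lessD[OF j] s], rule inT[OF j s])
      have "norm (D n ?x - D n ?y) \<le> B * norm (?x - ?y)"
        by (rule field_differentiable_bound[of "{0..T}" _ "D (Suc n)"]) (use der B xy in auto)
      also have "?x - ?y = - h" by (simp add: algebra_simps)
      finally have "\<bar>D n ?x - D n ?y\<bar> \<le> B * h" using h by simp
      then have "h ^ n * \<bar>D n ?x - D n ?y\<bar> \<le> h ^ n * (B * h)"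
        using h by (intro mult_left_mono) auto
      moreover have "\<bar>?g (Suc m) s\<bar> = h ^ n * \<bar>D n ?x - D n ?y\<bar>"
        using h by (simp add: m right_diff_distrib[symmetric] abs_mult)
      ultimately show "\<bar>?g (Suc m) s\<bar> \<le> h ^ n * (B * h)" by linarith
    qed
    then show "\<exists>\<tau>. degree \<tau> < n \<and>
      (\<forall>s\<in>{0..1}. \<bar>(D 0 ((real j + s) * h) - D 0 ((real (Suc j) + s) * h)) - poly \<tau> s\<bar>
         \<le> h ^ n * (B * h))"
      by (simp add: m less_Suc_eq_le)
  }
qed

subsection \<open>Splines and their derivatives\<close>

lemma dt_eqI:
  assumes "0 < T" "t \<in> {0..T}" "(f has_real_derivative d) (at t within {0..T})"
  shows "dt T f t = d"
  using vector_derivative_within_cbox[of 0 T t f d] assms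
  by (simp add: dt_def has_real_derivative_iff_has_vector_derivative)

lemma has_real_derivative_dt:
  assumes "f differentiable_on {0..T}" "t \<in> {0..T}"
  shows "(f has_real_derivative dt T f t) (at t within {0..T})"
  using assms by (simp add: dt_def has_real_derivative_iff_has_vector_derivative
      differentiable_on_def vector_derivative_works[symmetric])

lemma dt_lincomb:
  assumes "0 < T" "C_on T 1 u" "C_on T 1 v"
  shows "C_on T 1 (\<lambda>s. a * u s + b * v s)"
    and "\<And>t. t \<in> {0..T} \<Longrightarrow> dt T (\<lambda>s. a * u s + b * v s) t = a * dt T u t + b * dt T v t"
proof -
  have der: "((\<lambda>s. a * u s + b * v s) has_real_derivative a * dt T u t + b * dt T v t) (at t within {0..T})"
    if "t \<in> {0..T}" for t
    by (intro DERIV_add DERIV_cmult has_real_derivative_dt that) (use assms in auto)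
  then show eq: "dt T (\<lambda>s. a * u s + b * v s) t = a * dt T u t + b * dt T v t"
    if "t \<in> {0..T}" for t
    using dt_eqI[OF assms(1)] that by blast
  have "continuous_on {0..T} (\<lambda>t. a * dt T u t + b * dt T v t)"
    using assms by (intro continuous_intros) auto
  then have "continuous_on {0..T} (dt T (\<lambda>s. a * u s + b * v s))"
    by (rule continuous_on_eq) (use eq in auto)
  moreover have "(\<lambda>s. a * u s + b * v s) differentiable_on {0..T}"
    using der unfolding differentiable_on_def real_differentiable_def by blast
  ultimately show "C_on T 1 (\<lambda>s. a * u s + b * v s)" by simp
qed

lemma C_on_funpow:
  "C_on T m u \<Longrightarrow> i \<le> m \<Longrightarrow> C_on T (m - i) ((dt T ^^ i) u)"
proof (induction i)
  case (Suc i)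
  then have "C_on T (Suc (m - Suc i)) ((dt T ^^ i) u)" by (simp add: Suc_diff_Suc)
  then show ?case by simp
qed simp

lemma C_on_continuous: "C_on T m u \<Longrightarrow> continuous_on {0..T} u"
  by (cases m) (auto intro: differentiable_imp_continuous_on)

lemma mesh_cover:
  assumes "0 < T" "N \<ge> 1" "t \<in> {0..T}"
  obtains j s where "j < N" "s \<in> {0..1}" "t = (real j + s) * (T / real N)"
proof (cases "t = T")
  \<comment> \<open>The right end point is treated apart because the floor used below would assign
    it the cell number N, outside the mesh.\<close>
  case True
  have "real (N - 1) + 1 = real N" using assms(2) by simp
  then have "t = (real (N - 1) + 1) * (T / real N)" using True assms(2) by simp
  then show ?thesis using that[of "N - 1" 1] assms(2) by auto
next
  case False
  define x where "x = t * real N / T"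
  have x: "0 \<le> x" "x < real N" using assms False by (auto simp: x_def field_simps)
  define j where "j = nat \<lfloor>x\<rfloor>"
  have j: "real j \<le> x" "x < real j + 1" using x(1) by (auto simp: j_def)
  have "real j < real N" using j x by linarith
  moreover have "t = (real j + (x - real j)) * (T / real N)"
    using assms by (simp add: x_def)
  ultimately show ?thesis using that[of j "x - real j"] j by auto
qed

text \<open>The first derivative is described on closed cells, the second on open ones, since it may
  jump at the nodes. The division by h is the chain rule for the local coordinate.\<close>

lemma spline_derivative_pieces:
  assumes T: "0 < T" and N: "N \<ge> 1" and w: "w \<in> spline_space T (Suc (Suc n)) N"
  defines "h \<equiv> T / real N"
  shows "\<exists>G. \<forall>j<N. degree (G j) \<le> Suc n \<and>
    (\<forall>s\<in>{0..1}. dt T w ((real j + s) * h) = poly (G j) s) \<and>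
    (\<forall>s\<in>{0<..<1}. dt T (dt T w) ((real j + s) * h) = poly (pderiv (G j)) s / h)"
proof -
  have h: "h > 0" using T N by (simp add: h_def)
  have w': "w differentiable_on {0..T}"
    "\<forall>j<N. \<exists>q. degree q \<le> Suc (Suc n) \<and> (\<forall>t\<in>{real j * h..real (Suc j) * h}. w t = poly q t)"
    using w by (simp_all add: spline_space_def h_def)
  then obtain q where q: "\<And>j. j < N \<Longrightarrow> degree (q j) \<le> Suc (Suc n)"
    "\<And>j t. j < N \<Longrightarrow> t \<in> {real j * h..real (Suc j) * h} \<Longrightarrow> w t = poly (q j) t"
    by metis
  define G where "G j = pcompose (pderiv (q j)) [:real j * h, h:]" for j
  have I: "(real j + s) * h \<in> {real j * h..real (Suc j) * h}" if "s \<in> {0..1}" for j s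
    using that h by (auto intro!: mult_right_mono)
  have sub: "{real j * h..real (Suc j) * h} \<subseteq> {0..T}" if "j < N" for j
  proof -
    have "real (Suc j) * h \<le> real N * h" using that h by (intro mult_right_mono) auto
    moreover have "T = real N * h" using N by (simp add: h_def)
    moreover have "0 \<le> real j * h" using h by simp
    ultimately show ?thesis by auto
  qed
  have d1: "dt T w t = poly (pderiv (q j)) t"
    if j: "j < N" and t: "t \<in> {real j * h..real (Suc j) * h}" for j t
  proof -
    let ?I = "cbox (real j * h) (real (Suc j) * h)"
    have lt: "real j * h < real (Suc j) * h" using h by simp
    have "(w has_vector_derivative dt T w t) (at t within {0..T})"
      using has_real_derivative_dt[OF w'(1)] sub[OF j] t
      by (auto simp: has_real_derivative_iff_has_vector_derivative)
    then have "(w has_vector_derivative dt T w t) (at t within ?I)"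
      by (rule has_vector_derivative_within_subset) (use sub[OF j] in auto)
    moreover have "(w has_vector_derivative poly (pderiv (q j)) t) (at t within ?I)"
    proof (rule has_vector_derivative_transform)
      show "(poly (q j) has_vector_derivative poly (pderiv (q j)) t) (at t within ?I)"
        using poly_DERIV has_real_derivative_iff_has_vector_derivative
          has_field_derivative_at_within by blast
    qed (use q(2)[OF j] t in auto)
    ultimately show ?thesis
      using vector_derivative_within_cbox[OF lt] t by (metis box_real(2))
  qed
  have d2: "dt T (dt T w) t = poly (pderiv (pderiv (q j))) t"
    if j: "j < N" and t: "t \<in> {real j * h<..<real (Suc j) * h}" for j t
  proof (rule dt_eqI[OF T])
    show "t \<in> {0..T}" using sub[OF j] t by auto
    have "(dt T w has_real_derivative poly (pderiv (pderiv (q j))) t) (at t)"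
      by (rule DERIV_cong_ev[THEN iffD1, OF refl _ refl poly_DERIV])
        (use t d1[OF j] in \<open>auto simp: eventually_nhds intro!: exI[of _ "{real j * h<..<real (Suc j) * h}"]\<close>)
    then show "(dt T w has_real_derivative poly (pderiv (pderiv (q j))) t) (at t within {0..T})"
      by (rule has_field_derivative_at_within)
  qed
  show ?thesis
  proof (intro exI[of _ G] allI impI conjI ballI)
    fix j assume j: "j < N"
    have "degree (pderiv (q j)) \<le> Suc n"
      using q(1)[OF j] unfolding degree_pderiv by linarith
    then show "degree (G j) \<le> Suc n"
      using h by (simp add: G_def degree_pcompose)
    fix s :: real
    {
      assume "s \<in> {0..1}"
      then show "dt T w ((real j + s) * h) = poly (G j) s"
        using d1[OF j I] by (simp add: G_def poly_pcompose distrib_right)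
    }
    assume s: "s \<in> {0<..<1}"
    then have "(real j + s) * h \<in> {real j * h<..<real (Suc j) * h}"
      using h by (auto intro!: mult_strict_right_mono)
    then have "dt T (dt T w) ((real j + s) * h) = poly (pderiv (pderiv (q j))) ((real j + s) * h)"
      by (rule d2[OF j])
    also have "\<dots> = poly (pderiv (G j)) s / h"
      using h by (simp add: G_def pderiv_pcompose poly_pcompose pderiv_pCons algebra_simps)
    finally show "dt T (dt T w) ((real j + s) * h) = poly (pderiv (G j)) s / h" .
  qed
qed

lemma poly_antiderivative:
  "\<exists>P :: real poly. pderiv P = q \<and> degree P \<le> Suc (degree q)"
proof (intro exI conjI)
  let ?P = "\<Sum>i\<le>degree q. monom (coeff q i / real (Suc i)) (Suc i)"
  have "pderiv ?P = (\<Sum>i\<le>degree q. monom (coeff q i) i)"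
    by (simp add: higher_pderiv_sum[where n = 1, simplified] pderiv_monom del: of_nat_Suc)
  then show "pderiv ?P = q" by (simp add: poly_as_sum_of_monoms)
  show "degree ?P \<le> Suc (degree q)"
    by (intro degree_sum_le) (auto intro: order_trans[OF degree_monom_le])
qed

text \<open>Induction on the number k of cells already glued. The value required at k h is the
  matching condition that lets the next piece be attached continuously; asking for continuity on the
  whole line leaves the extension to the right free.\<close>

lemma glue_pieces:
  assumes h: "(0::real) < h" and match: "\<And>j. Suc j < N \<Longrightarrow> poly (G j) 1 = poly (G (Suc j)) 0"
  shows "k \<le> N \<Longrightarrow> \<exists>g. continuous_on UNIV g \<and> (k < N \<longrightarrow> g (real k * h) = poly (G k) 0) \<and>
    (\<forall>j<k. \<forall>s\<in>{0..1}. g ((real j + s) * h) = poly (G j) s)"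
proof (induction k)
  case 0
  show ?case by (intro exI[of _ "\<lambda>_. poly (G 0) 0"]) auto
next
  case (Suc k)
  then obtain g where g: "continuous_on UNIV g" "g (real k * h) = poly (G k) 0"
    "\<forall>j<k. \<forall>s\<in>{0..1}. g ((real j + s) * h) = poly (G j) s" by auto
  define g' where "g' t = (if t \<le> real k * h then g t else poly (G k) (t / h - real k))" for t
  have "continuous_on ({..real k * h} \<union> {real k * h..}) g'"
    unfolding g'_def
    by (rule continuous_on_If)
      (use g(1,2) h in \<open>auto intro!: continuous_intros intro: continuous_on_subset\<close>)
  moreover have "{..real k * h} \<union> {real k * h..} = UNIV" by auto
  ultimately have c: "continuous_on UNIV g'" by simp
  have gk: "g' ((real k + s) * h) = poly (G k) s" if "s \<in> {0..1}" for s
  proof (cases "s = 0")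
    case True
    then show ?thesis using g(2) by (simp add: g'_def)
  next
    case False
    then have "\<not> (real k + s) * h \<le> real k * h" using that h by simp
    then show ?thesis using h by (simp add: g'_def)
  qed
  have gj: "g' ((real j + s) * h) = poly (G j) s" if "j < k" "s \<in> {0..1}" for j s
  proof -
    have "real j + s \<le> real k" using that by (simp add: nat_less_real_le)
    then have "(real j + s) * h \<le> real k * h" using h by simp
    then show ?thesis using g(3) that by (simp add: g'_def)
  qed
  have "g' (real (Suc k) * h) = poly (G (Suc k)) 0" if "Suc k < N"
    using gk[of 1] match[OF that] by (simp add: add.commute)
  then show ?case using c gk gj by (intro exI[of _ g']) (auto simp: less_Suc_eq)
qed

text \<open>The spline is the integral from 0 of the glued derivative, which gives the C^1 property
  and the value 0 at once. On each cell it differs by a constant from a polynomial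
  antiderivative.\<close>

lemma spline_from_pieces:
  assumes T: "0 < T" and N: "N \<ge> 1"
    and deg: "\<And>j. j < N \<Longrightarrow> degree (G j) \<le> Suc n"
    and match: "\<And>j. Suc j < N \<Longrightarrow> poly (G j) 1 = poly (G (Suc j)) 0"
  defines "h \<equiv> T / real N"
  shows "\<exists>w\<in>spline_space T (Suc (Suc n)) N.
    \<forall>j<N. \<forall>s\<in>{0..1}. dt T w ((real j + s) * h) = poly (G j) s"
proof -
  have h: "h > 0" using T N by (simp add: h_def)
  obtain g where g: "continuous_on UNIV g"
    "\<forall>j<N. \<forall>s\<in>{0..1}. g ((real j + s) * h) = poly (G j) s"
    using glue_pieces[where G = G and N = N and k = N, OF h match] by auto
  define w where "w t = integral {0..t} g" for t
  have der: "(w has_real_derivative g t) (at t within {0..T})" if "t \<in> {0..T}" for t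
    unfolding w_def using that g(1) continuous_on_subset
    by (intro integral_has_real_derivative) auto
  have dtw: "dt T w t = g t" if "t \<in> {0..T}" for t
    using dt_eqI[OF T that der[OF that]] .
  have "continuous_on {0..T} (dt T w)"
    by (rule continuous_on_eq[of _ g]) (use g(1) continuous_on_subset dtw in auto)
  moreover have "w differentiable_on {0..T}"
    using der unfolding differentiable_on_def real_differentiable_def by blast
  ultimately have C1: "C_on T 1 w" by simp
  have inT: "(real j + s) * h \<in> {0..T}" if "j < N" "s \<in> {0..1}" for j s
    unfolding h_def by (rule mesh_interval[OF T that])
  have piece: "\<exists>q. degree q \<le> Suc (Suc n) \<and> (\<forall>t\<in>{real j * h..real (Suc j) * h}. w t = poly q t)"
    if j: "j < N" for j
  proof -
    let ?I = "{real j * h..real (Suc j) * h}"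
    define r where "r = pcompose (G j) [:- real j, 1 / h:]"
    have degr: "degree r \<le> Suc n" using deg[OF j] h by (simp add: r_def degree_pcompose)
    obtain P where P: "pderiv P = r" "degree P \<le> Suc (degree r)"
      using poly_antiderivative by blast
    have tI: "\<exists>s\<in>{0..1}. t = (real j + s) * h" if "t \<in> ?I" for t
      using that h by (intro bexI[of _ "t / h - real j"]) (auto simp: field_simps)
    have I: "?I \<subseteq> {0..T}" using tI inT[OF j] by blast
    have gI: "g t = poly r t" if t: "t \<in> ?I" for t
    proof -
      obtain s where s: "s \<in> {0..1}" "t = (real j + s) * h" using tI[OF t] by blast
      have "poly r t = poly (G j) s" using h by (simp add: r_def poly_pcompose s(2))
      then show ?thesis using g(2) j s by simp
    qed
    have "\<exists>c. \<forall>t\<in>?I. w t - poly P t = c"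
    proof (rule has_field_derivative_zero_constant)
      fix t assume t: "t \<in> ?I"
      have "(w has_real_derivative g t) (at t within ?I)"
        by (rule has_field_derivative_subset[OF der]) (use I t in auto)
      moreover have "(poly P has_real_derivative poly r t) (at t within ?I)"
        using poly_DERIV[of P t] P(1) has_field_derivative_at_within by auto
      ultimately have "((\<lambda>t. w t - poly P t) has_real_derivative g t - poly r t) (at t within ?I)"
        by (rule DERIV_diff)
      then show "((\<lambda>t. w t - poly P t) has_real_derivative 0) (at t within ?I)"
        using gI[OF t] by simp
    qed simp
    then obtain c where c: "\<forall>t\<in>?I. w t - poly P t = c" ..
    have "degree (P + [:c:]) \<le> Suc (Suc n)" using P(2) degr by (intro degree_add_le) auto
    moreover have "w t = poly (P + [:c:]) t" if "t \<in> ?I" for t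
      using c that by (simp add: algebra_simps)
    ultimately show ?thesis by blast
  qed
  have "w \<in> spline_space T (Suc (Suc n)) N"
    using C1 piece by (auto simp: spline_space_def h_def w_def)
  moreover have "\<forall>j<N. \<forall>s\<in>{0..1}. dt T w ((real j + s) * h) = poly (G j) s"
    using dtw inT g(2) by auto
  ultimately show ?thesis by blast
qed

section \<open>Integrals over the mesh\<close>

lemma set_integral_mesh_cell:
  fixes K :: "real \<Rightarrow> real" and j :: nat
  assumes h: "0 < h" and K: "continuous_on {0..1} K"
  defines "I \<equiv> {real j * h<..<real (Suc j) * h}"
  shows "set_integrable lborel I (\<lambda>t. K (t / h - real j))"
    and "(LINT t:I|lborel. K (t / h - real j)) = h * integral {0..1} K"
proof -
  let ?J = "{real j * h..real (Suc j) * h}"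
  have "continuous_on ?J (\<lambda>t. K (t / h - real j))"
    using h by (intro continuous_on_compose2[OF K] continuous_intros) (auto simp: field_simps)
  then have "set_integrable lborel ?J (\<lambda>t. K (t / h - real j))"
    by (rule borel_integrable_atLeastAtMost')
  then show i: "set_integrable lborel I (\<lambda>t. K (t / h - real j))"
    by (rule set_integrable_subset) (auto simp: I_def)
  have "(K has_integral integral {0..1} K) (cbox 0 1)"
    using K by (simp add: integrable_integral integrable_continuous_interval)
  from has_integral_affinity'[OF this, of "1 / h" "- real j"] h
  have "((\<lambda>t. K (t / h - real j)) has_integral h * integral {0..1} K) ?J"
    by (simp add: field_simps del: integral_open_interval_real)
  then have "integral I (\<lambda>t. K (t / h - real j)) = h * integral {0..1} K"
    unfolding I_def integral_open_interval_real[symmetric] by (rule integral_unique)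
  then show "(LINT t:I|lborel. K (t / h - real j)) = h * integral {0..1} K"
    using set_borel_integral_eq_integral(2)[OF i] by (rule trans[rotated])
qed

text \<open>The product is described on open cells only, so that it applies to second derivatives of
  splines, whose values at the nodes are unspecified; the finitely many nodes are discarded as a
  null set.\<close>

lemma L2_inner_mesh:
  assumes T: "0 < T" and N: "N \<ge> 1"
    and K: "\<And>j. j < N \<Longrightarrow> continuous_on {0..1} (K j)"
    and eq: "\<And>j s. j < N \<Longrightarrow> s \<in> {0<..<1} \<Longrightarrow>
      F ((real j + s) * (T / real N)) * G ((real j + s) * (T / real N)) = K j s"
  shows "L2_inner T F G = (\<Sum>j<N. T / real N * integral {0..1} (K j))"
proof -
  define h where "h = T / real N"
  have h: "h > 0" using T N by (simp add: h_def)
  define I where "I j = {real j * h<..<real (Suc j) * h}" for j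
  define k where "k = (\<lambda>j t. indicator (I j) t * K j (t / h - real j))"
  have k: "integrable lborel (k j)" "integral\<^sup>L lborel (k j) = h * integral {0..1} (K j)" if "j < N" for j
    using set_integral_mesh_cell[OF h K[OF that], of j]
    by (auto simp: set_integrable_def set_lebesgue_integral_def k_def I_def)
  have "L2_inner T F G = (LINT t|lborel. indicator {0<..<T} t * (F t * G t))"
    by (simp add: L2_inner_def set_lebesgue_integral_def)
  also have "\<dots> = (LINT t|lborel. (\<Sum>j<N. k j t))"
  proof (rule integral_discrete_difference[where X = "(\<lambda>j. real j * h) ` {..N}"])
    fix t assume t: "t \<notin> (\<lambda>j. real j * h) ` {..N}"
    have Th: "T = real N * h" using N by (simp add: h_def)
    show "indicator {0<..<T} t * (F t * G t) = (\<Sum>j<N. k j t)"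
    proof (cases "t \<in> {0<..<T}")
      case False
      have "t \<notin> I j" if "j < N" for j
      proof
        assume "t \<in> I j"
        moreover have "real (Suc j) * h \<le> real N * h" "0 \<le> real j * h"
          using that h by (auto intro!: mult_right_mono)
        ultimately show False using False Th by (auto simp: I_def)
      qed
      then show ?thesis using False by (simp add: k_def)
    next
      case True
      then obtain i s where i: "i < N" "s \<in> {0..1}" "t = (real i + s) * h"
        using mesh_cover[OF T N, of t] unfolding h_def by auto
      have "s \<noteq> 0" using t i by auto
      moreover have "s \<noteq> 1"
      proof
        assume "s = 1"
        then have "t = real (Suc i) * h" using i by simp
        then show False using t i(1) by (metis Suc_leI atMost_iff imageI)
      qed
      ultimately have s: "s \<in> {0<..<1}" using i by auto
      have kj: "k j t = (if j = i then K i s else 0)" for j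
      proof (cases "j = i")
        case True
        have "t \<in> I i" using s h i(3) by (auto simp: I_def intro!: mult_strict_right_mono)
        then show ?thesis using True i(3) h by (simp add: k_def)
      next
        case False
        have "t \<notin> I j"
        proof
          assume "t \<in> I j"
          then have "real j < real i + s" "real i + s < real j + 1"
            using h by (auto simp: I_def i(3) add.commute)
          then show False using False s by (auto simp: nat_less_real_le)
        qed
        then show ?thesis using False by (simp add: k_def)
      qed
      have "(\<Sum>j<N. k j t) = K i s" using i(1) by (simp add: kj)
      then show ?thesis using eq[OF i(1) s] True by (simp add: i(3) h_def)
    qed
  qed auto
  also have "\<dots> = (\<Sum>j<N. h * integral {0..1} (K j))"
    using k by (subst Bochner_Integration.integral_sum) auto
  finally show ?thesis by (simp add: h_def)
qed

subsection \<open>The projection\<close>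

lemma radau_iff:
  assumes "continuous_on {0..1} F" "degree G \<le> Suc n"
  shows "radau \<epsilon> n F G \<longleftrightarrow> (\<forall>\<psi>. degree \<psi> \<le> n \<longrightarrow>
    integral {0..1} (\<lambda>s. exp (- (\<epsilon> * s)) * poly G s * poly \<psi> s)
      = integral {0..1} (\<lambda>s. exp (- (\<epsilon> * s)) * F s * poly \<psi> s))"
proof -
  have "integral {0..1} (\<lambda>s. exp (- (\<epsilon> * s)) * (poly G s - F s) * poly \<psi> s)
    = integral {0..1} (\<lambda>s. exp (- (\<epsilon> * s)) * poly G s * poly \<psi> s)
      - integral {0..1} (\<lambda>s. exp (- (\<epsilon> * s)) * F s * poly \<psi> s)" for \<psi>
    unfolding right_diff_distrib left_diff_distrib
    by (intro integral_diff integrable_continuous_interval continuous_intros assms)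
  then show ?thesis using assms(2) by (simp add: radau_def)
qed

lemma continuous_on_mesh_cell:
  assumes "0 < T" "j < N" "continuous_on {0..T} f"
  shows "continuous_on {0..1} (\<lambda>s. f ((real j + s) * (T / real N)))"
  using mesh_interval[OF assms(1,2)]
  by (intro continuous_on_compose2[OF assms(3)] continuous_intros) blast

text \<open>The factor h from the change of variables cancels the 1/h in the second derivative of
  \<open>w\<close>, and the weight splits into e^(-j/N) times the weight of the reference
  cell.\<close>

lemma spline_test_integral:
  assumes T: "0 < T" and N: "N \<ge> 1" and \<phi>: "continuous_on {0..T} \<phi>"
    and W: "\<And>j s. j < N \<Longrightarrow> s \<in> {0<..<1} \<Longrightarrow>
      dt T (dt T w) ((real j + s) * (T / real N)) = poly (pderiv (W j)) s / (T / real N)"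
  shows "L2_inner T \<phi> (\<lambda>t. exp (- t / T) * dt T (dt T w) t)
    = (\<Sum>j<N. exp (- (real j / real N)) * integral {0..1} (\<lambda>s. exp (- (1 / real N * s)) *
        \<phi> ((real j + s) * (T / real N)) * poly (pderiv (W j)) s))"
proof -
  define h where "h = T / real N"
  have h: "h > 0" using T N by (simp add: h_def)
  define K where "K = (\<lambda>j s. \<phi> ((real j + s) * h) *
    (exp (- ((real j + s) * h) / T) * (poly (pderiv (W j)) s / h)))"
  have "L2_inner T \<phi> (\<lambda>t. exp (- t / T) * dt T (dt T w) t) = (\<Sum>j<N. h * integral {0..1} (K j))"
    unfolding h_def
  proof (rule L2_inner_mesh[OF T N])
    show "continuous_on {0..1} (K j)" if "j < N" for j
    proof -
      have "continuous_on {0..1} (\<lambda>s. \<phi> ((real j + s) * h))"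
        unfolding h_def by (rule continuous_on_mesh_cell[OF T that \<phi>])
      then show ?thesis unfolding K_def by (intro continuous_intros) (use h T in auto)
    qed
  qed (unfold K_def h_def, simp only: W)
  also have "\<dots> = (\<Sum>j<N. exp (- (real j / real N)) * integral {0..1} (\<lambda>s. exp (- (1 / real N * s)) *
        \<phi> ((real j + s) * h) * poly (pderiv (W j)) s))"
  proof (rule sum.cong[OF refl])
    fix j
    have e: "exp (- ((real j + s) * h) / T) = exp (- (real j / real N)) * exp (- (1 / real N * s))" for s
      using T N by (simp add: h_def exp_add[symmetric] field_simps)
    have "h * integral {0..1} (K j) = integral {0..1} (\<lambda>s. h * K j s)" by simp
    also have "\<dots> = integral {0..1} (\<lambda>s. exp (- (real j / real N)) * (exp (- (1 / real N * s)) *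
        \<phi> ((real j + s) * h) * poly (pderiv (W j)) s))"
      unfolding K_def e using h by (intro integral_cong) simp
    also have "\<dots> = exp (- (real j / real N)) * integral {0..1} (\<lambda>s. exp (- (1 / real N * s)) *
        \<phi> ((real j + s) * h) * poly (pderiv (W j)) s)" by (rule integral_mult_right)
    finally show "h * integral {0..1} (K j) = \<dots>" .
  qed
  finally show ?thesis by (simp add: h_def)
qed

text \<open>One direction sums the cell equations. The other tests with splines whose second
  derivative lives on a single cell, after which the nonzero factor e^(-j/N) cancels.\<close>

lemma galerkin_iff_radau:
  assumes T: "0 < T" and N: "N \<ge> 1" and f: "continuous_on {0..T} f" and g: "continuous_on {0..T} g"
    and deg: "\<And>j. j < N \<Longrightarrow> degree (G j) \<le> Suc n"
    and G: "\<And>j s. j < N \<Longrightarrow> s \<in> {0..1} \<Longrightarrow> g ((real j + s) * (T / real N)) = poly (G j) s"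
  shows "(\<forall>w\<in>spline_space T (Suc (Suc n)) N.
      L2_inner T g (\<lambda>t. exp (- t / T) * dt T (dt T w) t) =
      L2_inner T f (\<lambda>t. exp (- t / T) * dt T (dt T w) t)) \<longleftrightarrow>
    (\<forall>j<N. radau (1 / real N) n (\<lambda>s. f ((real j + s) * (T / real N))) (G j))"
    (is "?lhs \<longleftrightarrow> ?rhs")
proof -
  define I where "I \<phi> \<psi> j = integral {0..1} (\<lambda>s. exp (- (1 / real N * s)) *
        \<phi> ((real j + s) * (T / real N)) * poly \<psi> s)" for \<phi> \<psi> j
  have Ig: "I g \<psi> j = integral {0..1} (\<lambda>s. exp (- (1 / real N * s)) * poly (G j) s * poly \<psi> s)"
    if "j < N" for j \<psi>
    unfolding I_def by (rule integral_cong) (simp only: G[OF that])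
  have radau: "radau (1 / real N) n (\<lambda>s. f ((real j + s) * (T / real N))) (G j) \<longleftrightarrow>
      (\<forall>\<psi>. degree \<psi> \<le> n \<longrightarrow> I g \<psi> j = I f \<psi> j)" if "j < N" for j
    using radau_iff[OF continuous_on_mesh_cell[OF T that f] deg[OF that]]
    by (simp add: Ig[OF that]) (simp add: I_def)
  have L2: "L2_inner T \<phi> (\<lambda>t. exp (- t / T) * dt T (dt T w) t)
    = (\<Sum>j<N. exp (- (real j / real N)) * I \<phi> (pderiv (W j)) j)"
    if "continuous_on {0..T} \<phi>" "\<forall>j<N. \<forall>s\<in>{0<..<1}.
      dt T (dt T w) ((real j + s) * (T / real N)) = poly (pderiv (W j)) s / (T / real N)" for \<phi> w W
    unfolding I_def by (rule spline_test_integral[OF T N that(1)]) (use that(2) in blast)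
  show ?thesis
  proof
    assume ?rhs
    show ?lhs
    proof
      fix w assume "w \<in> spline_space T (Suc (Suc n)) N"
      from spline_derivative_pieces[OF T N this]
      obtain W where W: "\<And>j. j < N \<Longrightarrow> degree (W j) \<le> Suc n"
        "\<forall>j<N. \<forall>s\<in>{0<..<1}.
          dt T (dt T w) ((real j + s) * (T / real N)) = poly (pderiv (W j)) s / (T / real N)"
        by blast
      have "degree (pderiv (W j)) \<le> n" if "j < N" for j
        using W(1)[OF that] by (simp add: degree_pderiv)
      then show "L2_inner T g (\<lambda>t. exp (- t / T) * dt T (dt T w) t) =
          L2_inner T f (\<lambda>t. exp (- t / T) * dt T (dt T w) t)"
        unfolding L2[OF f W(2)] L2[OF g W(2)] using \<open>?rhs\<close> radau by (intro sum.cong) auto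
    qed
  next
    assume lhs: ?lhs
    show ?rhs
    proof (intro allI impI)
      fix j assume j: "j < N"
      have "I g \<psi> j = I f \<psi> j" if \<psi>: "degree \<psi> \<le> n" for \<psi>
      proof -
        obtain \<Psi> where \<Psi>: "pderiv \<Psi> = \<psi>" "degree \<Psi> \<le> Suc (degree \<psi>)"
          using poly_antiderivative by blast
        \<comment> \<open>The first derivative of the test spline: zero to the left of cell j, an
          antiderivative of \<psi> on it, and a constant to its right. It is continuous, and only
          cell j contributes to the second derivative.\<close>
        define W where "W i = (if i < j then 0 else if i = j then \<Psi> - [:poly \<Psi> 0:]
          else [:poly \<Psi> 1 - poly \<Psi> 0:])" for i
        have "degree (W i) \<le> Suc n" for i
          using \<Psi>(2) \<psi> by (auto simp: W_def intro!: degree_diff_le)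
        moreover have "poly (W i) 1 = poly (W (Suc i)) 0" for i
          by (auto simp: W_def)
        ultimately obtain w where w: "w \<in> spline_space T (Suc (Suc n)) N"
          "\<forall>i<N. \<forall>s\<in>{0..1}. dt T w ((real i + s) * (T / real N)) = poly (W i) s"
          using spline_from_pieces[OF T N] by metis
        from spline_derivative_pieces[OF T N w(1)]
        obtain W' where W':
          "\<And>j. j < N \<Longrightarrow> \<forall>s\<in>{0..1}. dt T w ((real j + s) * (T / real N)) = poly (W' j) s"
          "\<forall>j<N. \<forall>s\<in>{0<..<1}.
            dt T (dt T w) ((real j + s) * (T / real N)) = poly (pderiv (W' j)) s / (T / real N)"
          by blast
        \<comment> \<open>The construction of \<open>w\<close> prescribes only its first derivative.
          Polynomials agreeing on [0,1] coincide, so the pieces \<open>W'\<close> that describe the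
          second derivative are the prescribed ones.\<close>
        have WW: "W' i = W i" if "i < N" for i
          using w(2) W'(1)[OF that] that by (intro poly_eqI_on_unit) auto
        have pd: "pderiv (W i) = (if i = j then \<psi> else 0)" for i
          by (auto simp: W_def pderiv_diff \<Psi>(1) pderiv_pCons)
        have L2w: "L2_inner T \<phi> (\<lambda>t. exp (- t / T) * dt T (dt T w) t) = exp (- (real j / real N)) * I \<phi> \<psi> j"
          if "continuous_on {0..T} \<phi>" for \<phi>
        proof -
          have "L2_inner T \<phi> (\<lambda>t. exp (- t / T) * dt T (dt T w) t)
              = (\<Sum>i<N. if i = j then exp (- (real j / real N)) * I \<phi> \<psi> j else 0)"
            unfolding L2[OF that W'(2)] by (intro sum.cong) (auto simp: WW pd I_def)
          then show ?thesis using j by simp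
        qed
        show ?thesis using bspec[OF lhs w(1)] unfolding L2w[OF f] L2w[OF g] by simp
      qed
      then show "radau (1 / real N) n (\<lambda>s. f ((real j + s) * (T / real N))) (G j)"
        using radau[OF j] by blast
    qed
  qed
qed

text \<open>A relation rather than a function, so that existence and uniqueness can be shown
  separately. It makes sense for every C^1 function \<open>u\<close>, in particular for the splines
  themselves.\<close>

definition radau_spline :: "real \<Rightarrow> nat \<Rightarrow> nat \<Rightarrow> (real \<Rightarrow> real) \<Rightarrow> (real \<Rightarrow> real) \<Rightarrow> bool" where
  "radau_spline T p N u v \<longleftrightarrow> v \<in> spline_space T p N \<and> dt T v T = dt T u T \<and>
     (\<forall>w\<in>spline_space T p N.
        L2_inner T (dt T v) (\<lambda>t. exp (- t / T) * dt T (dt T w) t) =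
        L2_inner T (dt T u) (\<lambda>t. exp (- t / T) * dt T (dt T w) t))"

lemma radau_spline_pieces:
  assumes T: "0 < T" and N: "N \<ge> 1" and u: "C_on T 1 u"
    and v: "radau_spline T (Suc (Suc n)) N u v"
  obtains G where
    "\<And>j. j < N \<Longrightarrow> radau (1 / real N) n (\<lambda>s. dt T u ((real j + s) * (T / real N))) (G j)"
    "\<And>j s. j < N \<Longrightarrow> s \<in> {0..1} \<Longrightarrow> dt T v ((real j + s) * (T / real N)) = poly (G j) s"
    "\<And>j. Suc j < N \<Longrightarrow> poly (G j) 1 = poly (G (Suc j)) 0"
    "poly (G (N - 1)) 1 = dt T u T"
proof -
  have v': "v \<in> spline_space T (Suc (Suc n)) N" "dt T v T = dt T u T"
    using v by (auto simp: radau_spline_def)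
  from spline_derivative_pieces[OF T N v'(1)]
  obtain G where G: "\<And>j. j < N \<Longrightarrow> degree (G j) \<le> Suc n"
    "\<And>j s. j < N \<Longrightarrow> s \<in> {0..1} \<Longrightarrow> dt T v ((real j + s) * (T / real N)) = poly (G j) s"
    by blast
  have "continuous_on {0..T} (dt T u)" "continuous_on {0..T} (dt T v)"
    using u v' by (auto simp: spline_space_def)
  then have "\<forall>j<N. radau (1 / real N) n (\<lambda>s. dt T u ((real j + s) * (T / real N))) (G j)"
    using galerkin_iff_radau[OF T N _ _ G] v unfolding radau_spline_def by blast
  moreover have "poly (G j) 1 = poly (G (Suc j)) 0" if "Suc j < N" for j
    using G(2)[of j 1] G(2)[of "Suc j" 0] that by (simp add: add.commute)
  moreover have "poly (G (N - 1)) 1 = dt T u T"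
    using G(2)[of "N - 1" 1] N v'(2) by (simp add: of_nat_diff)
  ultimately show ?thesis using that G(2) by blast
qed

text \<open>The cells are solved from right to left: the last one gets the end value u'(T), every
  other one the left end value of its right neighbour.\<close>

lemma radau_spline_exists:
  assumes T: "0 < T" and N: "N \<ge> 1" and u: "C_on T 1 u"
  shows "\<exists>v. radau_spline T (Suc (Suc n)) N u v"
proof -
  define F where "F j s = dt T u ((real j + s) * (T / real N))" for j s
  have cu: "continuous_on {0..T} (dt T u)" using u by simp
  have cF: "continuous_on {0..1} (F j)" if "j < N" for j
    unfolding F_def by (rule continuous_on_mesh_cell[OF T that cu])
  \<comment> \<open>\<open>R\<close> counts cells from the right end. For k beyond N - 1 the
    truncated subtraction gives cell 0 again, so the infinite recursion never runs out of solvable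
    problems.\<close>
  have "\<exists>R. \<forall>k. (radau (1 / real N) n (F (N - 1 - k)) (R k) \<and> (k = 0 \<longrightarrow> poly (R k) 1 = dt T u T)) \<and>
      poly (R (Suc k)) 1 = poly (R k) 0"
  proof (rule dependent_nat_choice)
    show "\<exists>x. radau (1 / real N) n (F (N - 1 - 0)) x \<and> (0 = 0 \<longrightarrow> poly x 1 = dt T u T)"
      using radau_exists[OF cF[of "N - 1"]] N by auto
    show "\<exists>y. (radau (1 / real N) n (F (N - 1 - Suc k)) y \<and> (Suc k = 0 \<longrightarrow> poly y 1 = dt T u T)) \<and>
        poly y 1 = poly x 0" for x k
      using radau_exists[OF cF[of "N - 1 - Suc k"]] N by auto
  qed
  then obtain R where R: "\<And>k. radau (1 / real N) n (F (N - 1 - k)) (R k)"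
    "poly (R 0) 1 = dt T u T" "\<And>k. poly (R (Suc k)) 1 = poly (R k) 0" by blast
  define G where "G j = R (N - 1 - j)" for j
  have G: "radau (1 / real N) n (F j) (G j)" if "j < N" for j
  proof -
    have "N - 1 - (N - 1 - j) = j" using that by simp
    then show ?thesis using R(1)[of "N - 1 - j"] by (simp add: G_def)
  qed
  have deg: "degree (G j) \<le> Suc n" if "j < N" for j using G[OF that] by (simp add: radau_def)
  have "poly (G j) 1 = poly (G (Suc j)) 0" if "Suc j < N" for j
  proof -
    have "N - 1 - j = Suc (N - 1 - Suc j)" using that by simp
    then show ?thesis using R(3) by (simp add: G_def)
  qed
  then obtain v where v: "v \<in> spline_space T (Suc (Suc n)) N"
    "\<forall>j<N. \<forall>s\<in>{0..1}. dt T v ((real j + s) * (T / real N)) = poly (G j) s"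
    using spline_from_pieces[where G = G, OF T N deg] by blast
  have "dt T v ((real (N - 1) + 1) * (T / real N)) = poly (G (N - 1)) 1"
    by (intro v(2)[rule_format]) (use N in auto)
  then have v_end: "dt T v T = dt T u T" using N R(2) by (simp add: of_nat_diff G_def)
  have cv: "continuous_on {0..T} (dt T v)" using v(1) by (simp add: spline_space_def)
  have "\<forall>j<N. radau (1 / real N) n (\<lambda>s. dt T u ((real j + s) * (T / real N))) (G j)"
    using G unfolding F_def by blast
  then have "\<forall>w\<in>spline_space T (Suc (Suc n)) N.
        L2_inner T (dt T v) (\<lambda>t. exp (- t / T) * dt T (dt T w) t) =
        L2_inner T (dt T u) (\<lambda>t. exp (- t / T) * dt T (dt T w) t)"
    by (subst galerkin_iff_radau[where G = G, OF T N cu cv deg v(2)[rule_format]])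
  then have "radau_spline T (Suc (Suc n)) N u v"
    using v(1) v_end unfolding radau_spline_def by simp
  then show ?thesis by (intro exI[of _ v])
qed

section \<open>Uniqueness and linearity\<close>

lemma spline_eqI:
  assumes T: "0 < T" and N: "N \<ge> 1" and v: "v \<in> spline_space T p N" "w \<in> spline_space T p N"
    and eq: "\<And>t. t \<in> {0..T} \<Longrightarrow> dt T v t = dt T w t" and t: "t \<in> {0..T}"
  shows "v t = w t"
proof -
  have "\<exists>c. \<forall>t\<in>{0..T}. v t - w t = c"
  proof (rule has_field_derivative_zero_constant)
    fix t assume t: "t \<in> {0..T}"
    have "((\<lambda>t. v t - w t) has_real_derivative dt T v t - dt T w t) (at t within {0..T})"
      using v t by (intro DERIV_diff has_real_derivative_dt) (auto simp: spline_space_def)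
    then show "((\<lambda>t. v t - w t) has_real_derivative 0) (at t within {0..T})" using eq[OF t] by simp
  qed simp
  then obtain c where c: "\<forall>t\<in>{0..T}. v t - w t = c" ..
  moreover have "v 0 = 0" "w 0 = 0" using v by (auto simp: spline_space_def)
  ultimately have "c = 0" using T by (metis atLeastAtMost_iff diff_zero less_imp_le order_refl)
  then show ?thesis using c t by auto
qed

text \<open>Uniqueness on a cell passes to its left neighbour through the common nodal value,
  starting from u'(T). Equal derivatives give equal splines because both vanish at 0.\<close>

lemma radau_spline_unique:
  assumes T: "0 < T" and N: "N \<ge> 1" and u: "C_on T 1 u"
    and v: "radau_spline T (Suc (Suc n)) N u v" and w: "radau_spline T (Suc (Suc n)) N u w"
    and t: "t \<in> {0..T}"
  shows "v t = w t"
proof -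
  obtain G where G:
    "\<And>j. j < N \<Longrightarrow> radau (1 / real N) n (\<lambda>s. dt T u ((real j + s) * (T / real N))) (G j)"
    "\<And>j s. j < N \<Longrightarrow> s \<in> {0..1} \<Longrightarrow> dt T v ((real j + s) * (T / real N)) = poly (G j) s"
    "\<And>j. Suc j < N \<Longrightarrow> poly (G j) 1 = poly (G (Suc j)) 0"
    "poly (G (N - 1)) 1 = dt T u T"
    using radau_spline_pieces[OF T N u v] by blast
  obtain H where H:
    "\<And>j. j < N \<Longrightarrow> radau (1 / real N) n (\<lambda>s. dt T u ((real j + s) * (T / real N))) (H j)"
    "\<And>j s. j < N \<Longrightarrow> s \<in> {0..1} \<Longrightarrow> dt T w ((real j + s) * (T / real N)) = poly (H j) s"
    "\<And>j. Suc j < N \<Longrightarrow> poly (H j) 1 = poly (H (Suc j)) 0"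
    "poly (H (N - 1)) 1 = dt T u T"
    using radau_spline_pieces[OF T N u w] by blast
  have cu: "continuous_on {0..T} (dt T u)" using u by simp
  have cell: "G j = H j" if "j < N" "poly (G j) 1 = poly (H j) 1" for j
    by (rule radau_unique[OF _ continuous_on_mesh_cell[OF T that(1) cu] G(1) H(1) that(2)])
      (use that N in auto)
  have GH: "k < N \<Longrightarrow> G (N - Suc k) = H (N - Suc k)" for k
  proof (induction k)
    case 0
    then show ?case using cell[of "N - 1"] G(4) H(4) by simp
  next
    case (Suc k)
    then have i: "Suc (N - Suc (Suc k)) = N - Suc k" "Suc (N - Suc (Suc k)) < N" by auto
    have "poly (G (N - Suc (Suc k))) 1 = poly (H (N - Suc (Suc k))) 1"
      using G(3)[OF i(2)] H(3)[OF i(2)] Suc i(1) by simp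
    then show ?case using Suc.prems by (intro cell) auto
  qed
  have "dt T v x = dt T w x" if x: "x \<in> {0..T}" for x
  proof -
    obtain j s where js: "j < N" "s \<in> {0..1}" "x = (real j + s) * (T / real N)"
      using mesh_cover[OF T N x] by blast
    have "G j = H j" using GH[of "N - Suc j"] js(1) by simp
    then show ?thesis using G(2) H(2) js by simp
  qed
  moreover have "v \<in> spline_space T (Suc (Suc n)) N" "w \<in> spline_space T (Suc (Suc n)) N"
    using v w unfolding radau_spline_def by blast+
  ultimately show ?thesis using spline_eqI[OF T N] t by blast
qed

text \<open>Linearity is read off the cellwise formula, in which every integrand is continuous; the
  integrability of the discontinuous factor \<open>D\<close> never has to be discussed.\<close>

lemma L2_inner_lincomb_left:
  assumes T: "0 < T" and f: "continuous_on {0..T} f" and g: "continuous_on {0..T} g"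
    and k: "continuous_on {0..T} k" and N: "N \<ge> 1"
    and eq: "\<And>t. t \<in> {0..T} \<Longrightarrow> k t = a * f t + b * g t" and w: "w \<in> spline_space T (Suc (Suc n)) N"
  defines "D \<equiv> \<lambda>t. exp (- t / T) * dt T (dt T w) t"
  shows "L2_inner T k D = a * L2_inner T f D + b * L2_inner T g D"
proof -
  from spline_derivative_pieces[OF T N w]
  obtain W where W: "\<And>j s. j < N \<Longrightarrow> s \<in> {0<..<1} \<Longrightarrow>
      dt T (dt T w) ((real j + s) * (T / real N)) = poly (pderiv (W j)) s / (T / real N)"
    by blast
  let ?I = "\<lambda>\<phi> j s. exp (- (1 / real N * s)) * \<phi> ((real j + s) * (T / real N)) * poly (pderiv (W j)) s"
  have L: "L2_inner T \<phi> D = (\<Sum>j<N. exp (- (real j / real N)) * integral {0..1} (?I \<phi> j))"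
    if "continuous_on {0..T} \<phi>" for \<phi>
    unfolding D_def by (rule spline_test_integral[OF T N that W])
  have "integral {0..1} (?I k j) = a * integral {0..1} (?I f j) + b * integral {0..1} (?I g j)"
    if j: "j < N" for j
  proof -
    have i: "?I \<phi> j integrable_on {0..1}" if "continuous_on {0..T} \<phi>" for \<phi>
      using continuous_on_mesh_cell[OF T j that]
      by (intro integrable_continuous_interval continuous_intros) auto
    have "integral {0..1} (?I k j) = integral {0..1} (\<lambda>s. a * ?I f j s + b * ?I g j s)"
      using eq mesh_interval[OF T j] by (intro integral_cong) (simp add: algebra_simps)
    also have "\<dots> = a * integral {0..1} (?I f j) + b * integral {0..1} (?I g j)"
      by (subst integral_add) (use i[OF f] i[OF g] in \<open>auto intro!: integrable_on_mult_right\<close>)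
    finally show ?thesis .
  qed
  then have "(\<Sum>j<N. exp (- (real j / real N)) * integral {0..1} (?I k j))
    = (\<Sum>j<N. a * (exp (- (real j / real N)) * integral {0..1} (?I f j))
        + b * (exp (- (real j / real N)) * integral {0..1} (?I g j)))"
    by (intro sum.cong) (auto simp: algebra_simps)
  then show ?thesis
    unfolding L[OF f] L[OF g] L[OF k] by (simp only: sum.distrib sum_distrib_left)
qed

lemma C_on_1_spline: "v \<in> spline_space T p N \<Longrightarrow> C_on T 1 v"
  by (simp add: spline_space_def)

lemma spline_space_lincomb:
  assumes T: "0 < T" and v: "v \<in> spline_space T p N" "w \<in> spline_space T p N"
  shows "(\<lambda>s. a * v s + b * w s) \<in> spline_space T p N"
  unfolding spline_space_def
proof (intro CollectI conjI allI impI)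
  show "C_on T 1 (\<lambda>s. a * v s + b * w s)"
    using v by (intro dt_lincomb T C_on_1_spline)
  show "a * v 0 + b * w 0 = 0" using v by (simp add: spline_space_def)
  fix j assume j: "j < N"
  let ?I = "{real j * (T / real N)..real (Suc j) * (T / real N)}"
  obtain q r where "degree q \<le> p" "\<forall>t\<in>?I. v t = poly q t" "degree r \<le> p" "\<forall>t\<in>?I. w t = poly r t"
    using v j unfolding spline_space_def by blast
  then show "\<exists>q. degree q \<le> p \<and> (\<forall>t\<in>?I. a * v t + b * w t = poly q t)"
    by (intro exI[of _ "smult a q + smult b r"])
      (auto intro!: degree_add_le intro: order_trans[OF degree_smult_le])
qed

lemma radau_spline_lincomb:
  assumes T: "0 < T" and N: "N \<ge> 1" and u: "C_on T 1 u" "C_on T 1 u'"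
    and v: "radau_spline T (Suc (Suc n)) N u v" "radau_spline T (Suc (Suc n)) N u' v'"
  shows "radau_spline T (Suc (Suc n)) N (\<lambda>s. a * u s + b * u' s) (\<lambda>s. a * v s + b * v' s)"
proof -
  let ?S = "spline_space T (Suc (Suc n)) N"
  have S: "v \<in> ?S" "v' \<in> ?S" using v by (auto simp: radau_spline_def)
  have cv: "C_on T 1 v" "C_on T 1 v'" using S C_on_1_spline by auto
  have cc: "continuous_on {0..T} (dt T f)" if "C_on T 1 f" for f using that by simp
  note L = L2_inner_lincomb_left[OF T cc cc cc[OF dt_lincomb(1)[OF T]] N dt_lincomb(2)[OF T]]
  show ?thesis
    unfolding radau_spline_def
  proof (intro conjI ballI)
    show "(\<lambda>s. a * v s + b * v' s) \<in> ?S" by (rule spline_space_lincomb[OF T S])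
    show "dt T (\<lambda>s. a * v s + b * v' s) T = dt T (\<lambda>s. a * u s + b * u' s) T"
      using dt_lincomb(2)[OF T cv, of T] dt_lincomb(2)[OF T u, of T] T v
      by (simp add: radau_spline_def)
    fix w assume w: "w \<in> ?S"
    show "L2_inner T (dt T (\<lambda>s. a * v s + b * v' s)) (\<lambda>t. exp (- t / T) * dt T (dt T w) t) =
        L2_inner T (dt T (\<lambda>s. a * u s + b * u' s)) (\<lambda>t. exp (- t / T) * dt T (dt T w) t)"
      using L[OF u u u _ w] L[OF cv cv cv _ w] v w by (simp add: radau_spline_def)
  qed
qed

section \<open>Order of convergence\<close>

lemma L2_norm_le:
  assumes T: "0 < T" and f: "continuous_on {0..T} f" and M: "\<And>t. t \<in> {0..T} \<Longrightarrow> \<bar>f t\<bar> \<le> M"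
  shows "L2_norm T f \<le> sqrt T * M"
proof -
  have M0: "0 \<le> M" using M[of 0] T by simp
  have cf: "continuous_on {0..1} (\<lambda>s. f (s * T))"
    using continuous_on_mesh_cell[OF T _ f, of 0 1] by simp
  \<comment> \<open>The mesh with a single cell turns the Lebesgue integral into one over the unit
    interval.\<close>
  have "L2_inner T f f = (\<Sum>j<1. T / real 1 * integral {0..1} (\<lambda>s. f ((real j + s) * (T / real 1)) * f ((real j + s) * (T / real 1))))"
    by (rule L2_inner_mesh[OF T]) (auto intro!: continuous_on_mult cf)
  also have "\<dots> = T * integral {0..1} (\<lambda>s. f (s * T) * f (s * T))" by simp
  also have "\<dots> \<le> T * integral {0..1} (\<lambda>s::real. M\<^sup>2)"
  proof (intro mult_left_mono integral_le)
    show "(\<lambda>s. f (s * T) * f (s * T)) integrable_on {0..1}"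
      by (intro integrable_continuous_interval continuous_on_mult cf)
    fix s :: real assume "s \<in> {0..1}"
    then have "\<bar>f (s * T)\<bar> \<le> M" using mesh_interval[OF T, of 0 1 s] M by simp
    then show "f (s * T) * f (s * T) \<le> M\<^sup>2"
      using power_mono[of "\<bar>f (s * T)\<bar>" M 2] by (simp add: power2_eq_square)
  qed (use T in \<open>auto simp: integrable_const_ivl\<close>)
  also have "\<dots> = T * M\<^sup>2" by simp
  finally show ?thesis
    unfolding L2_norm_def using M0 by (metis real_sqrt_le_mono real_sqrt_mult real_sqrt_pow2_iff real_sqrt_unique)
qed

text \<open>Of the n + 3 derivatives of u', n + 2 serve the approximation on one cell and the last
  one the comparison of neighbouring cells.\<close>

lemma radau_spline_error:
  assumes T: "0 < T" and n: "even n" and u: "C_on T (n + 4) u"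
  shows "\<exists>C>0. \<forall>N\<ge>1. \<forall>v. radau_spline T (Suc (Suc n)) N u v \<longrightarrow>
    L2_norm T (\<lambda>t. dt T u t - dt T v t) \<le> C * (T / real N) ^ Suc (Suc n)"
proof -
  have u1: "C_on T 1 u"
    using u by (simp add: eval_nat_numeral differentiable_imp_continuous_on)
  have cu: "continuous_on {0..T} (dt T u)" using u1 by simp
  define D where "D i = (dt T ^^ Suc i) u" for i
  have D0: "D 0 = dt T u" by (simp add: D_def)
  have CD: "C_on T (n + 4 - Suc i) (D i)" if "i \<le> n + 3" for i
    unfolding D_def by (rule C_on_funpow[OF u]) (use that in simp)
  have der: "(D i has_real_derivative D (Suc i) x) (at x within {0..T})"
    if "x \<in> {0..T}" "i \<le> n + 2" for i x
  proof -
    have "n + 4 - Suc i = Suc (n + 2 - i)" using that(2) by simp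
    then have "D i differentiable_on {0..T}" using CD[of i] that(2) by simp
    from has_real_derivative_dt[OF this that(1)] show ?thesis by (simp add: D_def)
  qed
  obtain B1 where B1: "\<forall>x\<in>{0..T}. \<bar>D (n + 2) x\<bar> \<le> B1"
    using continuous_on_interval_bounded[OF C_on_continuous[OF CD[of "n + 2"]]] by auto
  obtain B2 where B2: "\<forall>x\<in>{0..T}. \<bar>D (n + 3) x\<bar> \<le> B2"
    using continuous_on_interval_bounded[OF C_on_continuous[OF CD[of "n + 3"]]] by auto
  define B where "B = max 0 (max B1 B2)"
  have B: "B \<ge> 0" "\<And>x. x \<in> {0..T} \<Longrightarrow> \<bar>D (Suc (Suc n)) x\<bar> \<le> B"
    "\<And>x. x \<in> {0..T} \<Longrightarrow> \<bar>D (Suc (Suc (Suc n))) x\<bar> \<le> B"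
    using B1 B2 by (auto simp: B_def le_max_iff_disj eval_nat_numeral)
  obtain C where C: "C > 0" and err: "\<And>N F G A. N \<ge> 1 \<Longrightarrow>
    (\<forall>j<N. continuous_on {0..1} (F j) \<and> radau (1 / real N) n (F j) (G j)) \<Longrightarrow>
    (\<forall>j. Suc j < N \<longrightarrow> F j 1 = F (Suc j) 0 \<and> poly (G j) 1 = poly (G (Suc j)) 0) \<Longrightarrow>
    poly (G (N - 1)) 1 = F (N - 1) 1 \<Longrightarrow>
    (\<forall>j<N. \<exists>\<tau>. degree \<tau> \<le> Suc n \<and> (\<forall>s\<in>{0..1}. \<bar>F j s - poly \<tau> s\<bar> \<le> A)) \<Longrightarrow>
    (\<forall>j. Suc j < N \<longrightarrow> (\<exists>\<tau>. degree \<tau> \<le> Suc n \<and>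
        (\<forall>s\<in>{0..1}. \<bar>(F j s - F (Suc j) s) - poly \<tau> s\<bar> \<le> A / real N))) \<Longrightarrow>
    (\<forall>j<N. \<forall>s\<in>{0..1}. \<bar>poly (G j) s - F j s\<bar> \<le> C * A)"
    using radau_chain_error[OF n] by (elim exE conjE) (rule that, assumption, blast)
  \<comment> \<open>The factor 1 + T lets one \<open>A\<close> satisfy both requirements: A must
    exceed h^p B, and A/N must exceed h^p B h = h^p B T / N. The dependence on \<open>u\<close>
    enters through \<open>B\<close>; the final + 1 makes the constant positive.\<close>
  define C' where "C' = sqrt T * (C * (B * (1 + T))) + 1"
  have "L2_norm T (\<lambda>t. dt T u t - dt T v t) \<le> C' * (T / real N) ^ Suc (Suc n)"
    if N: "N \<ge> 1" and v: "radau_spline T (Suc (Suc n)) N u v" for N v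
  proof -
    define h where "h = T / real N"
    have h: "h > 0" using T N by (simp add: h_def)
    define A where "A = h ^ Suc (Suc n) * (B * (1 + T))"
    obtain G where G:
      "\<And>j. j < N \<Longrightarrow> radau (1 / real N) n (\<lambda>s. dt T u ((real j + s) * h)) (G j)"
      "\<And>j s. j < N \<Longrightarrow> s \<in> {0..1} \<Longrightarrow> dt T v ((real j + s) * h) = poly (G j) s"
      "\<And>j. Suc j < N \<Longrightarrow> poly (G j) 1 = poly (G (Suc j)) 0"
      "poly (G (N - 1)) 1 = dt T u T"
      unfolding h_def using radau_spline_pieces[OF T N u1 v] by blast
    have A1: "h ^ Suc (Suc n) * B \<le> A"
      unfolding A_def using h B(1) T by (intro mult_left_mono) (auto simp: mult_le_cancel_left1)
    have A2: "h ^ Suc (Suc n) * (B * h) \<le> A / real N"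
    proof -
      have "h ^ Suc (Suc n) * (B * (T / real N)) \<le> h ^ Suc (Suc n) * (B * ((1 + T) / real N))"
        using h B(1) N by (intro mult_left_mono divide_right_mono) auto
      then show ?thesis by (simp add: A_def h_def)
    qed
    have bound: "\<forall>j<N. \<forall>s\<in>{0..1}. \<bar>poly (G j) s - dt T u ((real j + s) * h)\<bar> \<le> C * A"
    proof (rule err[OF N])
      show "\<forall>j<N. continuous_on {0..1} (\<lambda>s. dt T u ((real j + s) * h)) \<and>
          radau (1 / real N) n (\<lambda>s. dt T u ((real j + s) * h)) (G j)"
        using G(1) continuous_on_mesh_cell[OF T _ cu] unfolding h_def by blast
      show "\<forall>j. Suc j < N \<longrightarrow> dt T u ((real j + 1) * h) = dt T u ((real (Suc j) + 0) * h) \<and>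
          poly (G j) 1 = poly (G (Suc j)) 0"
        using G(3) by (simp add: add.commute)
      show "poly (G (N - 1)) 1 = dt T u ((real (N - 1) + 1) * h)"
        using G(4) N by (simp add: of_nat_diff h_def)
      show "\<forall>j<N. \<exists>\<tau>. degree \<tau> \<le> Suc n \<and>
          (\<forall>s\<in>{0..1}. \<bar>dt T u ((real j + s) * h) - poly \<tau> s\<bar> \<le> A)"
      proof (intro allI impI)
        fix j assume j: "j < N"
        have "\<exists>\<tau>. degree \<tau> < Suc (Suc n) \<and>
            (\<forall>s\<in>{0..1}. \<bar>D 0 ((real j + s) * h) - poly \<tau> s\<bar> \<le> h ^ Suc (Suc n) * B)"
          unfolding h_def by (rule mesh_taylor(1)[where D = D]) (use T N j B(2,3) in \<open>auto intro!: der\<close>)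
        then show "\<exists>\<tau>. degree \<tau> \<le> Suc n \<and>
          (\<forall>s\<in>{0..1}. \<bar>dt T u ((real j + s) * h) - poly \<tau> s\<bar> \<le> A)"
          unfolding D0 less_Suc_eq_le using A1 order_trans by blast
      qed
      show "\<forall>j. Suc j < N \<longrightarrow> (\<exists>\<tau>. degree \<tau> \<le> Suc n \<and>
          (\<forall>s\<in>{0..1}. \<bar>(dt T u ((real j + s) * h) - dt T u ((real (Suc j) + s) * h)) - poly \<tau> s\<bar>
             \<le> A / real N))"
      proof (intro allI impI)
        fix j assume j: "Suc j < N"
        have "\<exists>\<tau>. degree \<tau> < Suc (Suc n) \<and>
            (\<forall>s\<in>{0..1}. \<bar>(D 0 ((real j + s) * h) - D 0 ((real (Suc j) + s) * h)) - poly \<tau> s\<bar>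
              \<le> h ^ Suc (Suc n) * (B * h))"
          unfolding h_def by (rule mesh_taylor(2)[where D = D]) (use T N j B(2,3) in \<open>auto intro!: der\<close>)
        then show "\<exists>\<tau>. degree \<tau> \<le> Suc n \<and>
          (\<forall>s\<in>{0..1}. \<bar>(dt T u ((real j + s) * h) - dt T u ((real (Suc j) + s) * h)) - poly \<tau> s\<bar>
             \<le> A / real N)"
          unfolding D0 less_Suc_eq_le using A2 order_trans by blast
      qed
    qed
    have "L2_norm T (\<lambda>t. dt T u t - dt T v t) \<le> sqrt T * (C * A)"
    proof (rule L2_norm_le[OF T])
      have "continuous_on {0..T} (dt T v)" using v by (simp add: radau_spline_def spline_space_def)
      then show "continuous_on {0..T} (\<lambda>t. dt T u t - dt T v t)"
        using cu by (intro continuous_on_diff)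
      fix t assume "t \<in> {0..T}"
      then obtain j s where js: "j < N" "s \<in> {0..1}" "t = (real j + s) * h"
        using mesh_cover[OF T N, of t] unfolding h_def by blast
      then show "\<bar>dt T u t - dt T v t\<bar> \<le> C * A"
        using bound G(2)[OF js(1,2)] by (simp add: abs_minus_commute)
    qed
    also have "sqrt T * (C * A) = (sqrt T * (C * (B * (1 + T)))) * h ^ Suc (Suc n)"
      by (simp add: A_def)
    also have "\<dots> \<le> C' * h ^ Suc (Suc n)"
      unfolding C'_def using h by (intro mult_right_mono) auto
    finally show ?thesis by (simp add: h_def)
  qed
  moreover have "C' > 0"
    unfolding C'_def using T C B(1) by (intro add_nonneg_pos mult_nonneg_nonneg) auto
  ultimately show ?thesis by blast
qed

theorem corollary3p17:
  fixes T :: real and p :: nat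
  assumes "T > 0" and "p \<ge> 2" and "even p"
  shows "\<exists>Q :: nat \<Rightarrow> (real \<Rightarrow> real) \<Rightarrow> (real \<Rightarrow> real).
    (\<forall>N\<ge>1. projection_operator T (H2_0 T) (spline_space T p N) (Q N) \<and>
       (\<forall>u\<in>H2_0 T.
          dt T (Q N u) T = dt T u T \<and>
          (\<forall>w\<in>spline_space T p N.
             L2_inner T (dt T (Q N u)) (\<lambda>t. exp (- t / T) * dt T (dt T w) t) =
             L2_inner T (dt T u) (\<lambda>t. exp (- t / T) * dt T (dt T w) t)))) \<and>
    (\<exists>m\<ge>2. \<forall>u\<in>H2_0 T. C_on T m u \<longrightarrow>
       (\<exists>C>0. \<forall>N\<ge>1.
          L2_norm T (\<lambda>t. dt T u t - dt T (Q N u) t) \<le> C * (T / real N) ^ p))"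
proof -
  obtain n where p: "p = Suc (Suc n)" using \<open>p \<ge> 2\<close> by (metis add_2_eq_Suc le_Suc_ex)
  have n: "even n" using \<open>even p\<close> p by simp
  note T = \<open>T > 0\<close>
  \<comment> \<open>The choice is determined on [0,T] by uniqueness. Linearity follows because a
    combination of projections satisfies the conditions for the combined function.\<close>
  define Q where "Q N u = (SOME v. radau_spline T p N u v)" for N u
  have Q: "radau_spline T p N u (Q N u)" if "N \<ge> 1" "C_on T 1 u" for N u
    unfolding Q_def p by (rule someI_ex[OF radau_spline_exists[OF T that]])
  have Q_unique: "Q N u t = v t"
    if "N \<ge> 1" "C_on T 1 u" "radau_spline T p N u v" "t \<in> {0..T}" for N u v t
    using radau_spline_unique[OF T that(1,2)] Q[OF that(1,2)] that(3,4) unfolding p by blast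
  have H: "C_on T 1 u" if "u \<in> H2_0 T" for u using that unfolding H2_0_def H2_def by blast
  have "projection_operator T (H2_0 T) (spline_space T p N) (Q N)" if N: "N \<ge> 1" for N
    unfolding projection_operator_def
  proof (intro conjI ballI allI)
    show "Q N u \<in> spline_space T p N" if "u \<in> H2_0 T" for u
      using Q[OF N H[OF that]] unfolding radau_spline_def by blast
    show "Q N (\<lambda>s. a * u s + b * v s) t = a * Q N u t + b * Q N v t"
      if "u \<in> H2_0 T" "v \<in> H2_0 T" "t \<in> {0..T}" for u v a b t
    proof (rule Q_unique[OF N dt_lincomb(1)[OF T H[OF that(1)] H[OF that(2)]] _ that(3)])
      show "radau_spline T p N (\<lambda>s. a * u s + b * v s) (\<lambda>t. a * Q N u t + b * Q N v t)"
        using radau_spline_lincomb[OF T N H[OF that(1)] H[OF that(2)]]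
          Q[OF N H[OF that(1)]] Q[OF N H[OF that(2)]] unfolding p by blast
    qed
    \<comment> \<open>A spline satisfies its own defining conditions trivially, and uniqueness asks
      only that it be C^1.\<close>
    show "Q N w t = w t" if "w \<in> spline_space T p N" "t \<in> {0..T}" for w t
      by (rule Q_unique[OF N C_on_1_spline[OF that(1)] _ that(2)])
        (use that(1) in \<open>simp add: radau_spline_def\<close>)
  qed
  moreover have "\<forall>u\<in>H2_0 T. C_on T (n + 4) u \<longrightarrow>
       (\<exists>C>0. \<forall>N\<ge>1. L2_norm T (\<lambda>t. dt T u t - dt T (Q N u) t) \<le> C * (T / real N) ^ p)"
    using radau_spline_error[OF T n] Q H unfolding p by meson
  moreover have "n + 4 \<ge> 2" by simp
  ultimately show ?thesis
    using Q H unfolding radau_spline_def by (intro exI[of _ Q]) blast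
qed

end
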